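(* Let $F,G,H$ be functions as in the context and suppose that $$\lim_{s\to\infty}\Big(F(H(s))-G^{-1}(1)\,s\Big)=\infty.$$ Let $T:\mathcal{X}\to[-\infty,\infty]$ be the associated transformed norm risk measure, and let $\overline{T}(X)=\sup_{\pi\in\Pi}T(\mathbb{E}[X|\pi])$ for $X\in L^1$. Then $\overline{T}$ is $\|\cdot\|_1$ lower semicontinuous, convex, monotone, cash-additive and dilatation monotone on $L^1$, and is given by the formula $$\overline{T}(X)=\inf_{s\in\mathbb{R}}\{\overline{F}(\|H(s-X)\|_G)-s\},\qquad X\in L^1.$$
   Context: $(\Omega,\mathcal{F},\mathbb{P})$ is a fixed nonatomic probability space; $L^1$ is the space of integrable random variables modulo a.s. equality with norm $\|\cdot\|_1$. $\Pi$ is the collection of all finite measurable partitions of $\Omega$ whose members have nonzero probability, and $\mathbb{E}[X|\pi]:=\mathbb{E}[X|\sigma(\pi)]$, where $\sigma(\pi)$ is the $\sigma$-algebra generated by $\pi$. An Orlicz function is a left-continuous convex $G:[0,\infty)\to[0,\infty]$ with $\lim_{x\to0^+}G(x)=G(0)=0$ and $\lim_{x\to\infty}G(x)=\infty$. For a random variable $X$, the Luxemburg norm is $\|X\|_G=\inf\{\lambda>0:\mathbb{E}[G(|X|/\lambda)]\le1\}$ ($=\infty$ if no such $\lambda$ exists), and the Orlicz space is $L^G=\{X\in L^1:\mathbb{E}[G(c|X|)]<\infty\text{ for some }c>0\}=\{X\in L^1:\|X\|_G<\infty\}$. $G^{-1}(1):=\sup\{t>0:G(t)\le1\}$. "Increasing"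 means $x\le y\Rightarrow V(x)\le V(y)$. Standing assumptions: $F:[0,\infty)\to(-\infty,\infty]$ is left-continuous, increasing, convex, not identically $\infty$, with $\lim_{x\to\infty}F(x)=\infty$; $G$ is a real-valued Orlicz function; $H:\mathbb{R}\to[0,\infty)$ is increasing and convex with $\lim_{x\to\infty}H(x)=\infty$. $\overline{F}:[0,\infty]\to(-\infty,\infty]$ equals $F$ on $[0,\infty)$ and $\overline{F}(\infty)=\infty$. $\mathcal{X}=\{X\in L^1:H(s-X)\in L^G\text{ for all }s\in\mathbb{R}\}$ (it contains $L^\infty$), and $T(X)=\inf_{s\in\mathbb{R}}\{F(\|H(s-X)\|_G)-s\}$ for $X\in\mathcal{X}$. A functional $\rho:L^1\to[-\infty,\infty]$ is dilatation monotone if $\rho(\mathbb{E}[X|\pi])\le\rho(X)$ for all $X\in L^1$, $\pi\in\Pi$; convex if $\rho(\lambda X+(1-\lambda)Y)\le\lambda\rho(X)+(1-\lambda)\rho(Y)$ for $\lambda\in(0,1)$; cash-additive if $\rho(X+s)=\rho(X)-s$ for all $s\in\mathbb{R}$; monotone if $X\ge Y$ implies $\rho(X)\le\rho(Y)$; $\|\cdot\|_1$ lower semicontinuous if $\{\rho\le\lambda\}$ is $\|\cdot\|_1$-closed for every $\lambda\in\mathbb{R}$. *)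

theory Defs
  imports "HOL-Probability.Probability"
begin

definition nonatomic :: "'a measure \<Rightarrow> bool" where
  "nonatomic M \<longleftrightarrow> (\<forall>A\<in>sets M. 0 < measure M A \<longrightarrow>
     (\<exists>B\<in>sets M. B \<subseteq> A \<and> 0 < measure M B \<and> measure M B < measure M A))"

text \<open>
  Elements of \<open>L\<^sup>1\<close> are represented by integrable functions, without passing to the quotient by
  almost sure equality. The \<open>L\<^sup>1\<close>-norm is then only a seminorm, and \<open>L1_topology\<close> is the topology
  of this seminorm; its closed sets are the preimages of the norm-closed sets of classes.
\<close>

definition L1 :: "'a measure \<Rightarrow> ('a \<Rightarrow> real) set" where
  "L1 M = {X. integrable M X}"

definition L1_norm :: "'a measure \<Rightarrow> ('a \<Rightarrow> real) \<Rightarrow> real" where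
  "L1_norm M X = (\<integral>\<omega>. \<bar>X \<omega>\<bar> \<partial>M)"

definition L1_open :: "'a measure \<Rightarrow> ('a \<Rightarrow> real) set \<Rightarrow> bool" where
  "L1_open M U \<longleftrightarrow> U \<subseteq> L1 M \<and>
     (\<forall>X\<in>U. \<exists>e>0. \<forall>Y\<in>L1 M. L1_norm M (\<lambda>\<omega>. Y \<omega> - X \<omega>) < e \<longrightarrow> Y \<in> U)"

definition L1_topology :: "'a measure \<Rightarrow> ('a \<Rightarrow> real) topology" where
  "L1_topology M = topology (L1_open M)"

lemma istopology_L1_open: "istopology (L1_open M)"
  unfolding istopology_def
proof (intro conjI allI impI)
  fix S T assume S: "L1_open M S" and T: "L1_open M T"
  show "L1_open M (S \<inter> T)"
    unfolding L1_open_def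
  proof (intro conjI ballI)
    show "S \<inter> T \<subseteq> L1 M" using S by (auto simp: L1_open_def)
    fix X assume "X \<in> S \<inter> T"
    then have "X \<in> S" "X \<in> T" by auto
    obtain d where d: "d > 0" "\<forall>Y\<in>L1 M. L1_norm M (\<lambda>\<omega>. Y \<omega> - X \<omega>) < d \<longrightarrow> Y \<in> S"
      using bspec[OF conjunct2[OF S[unfolded L1_open_def]] \<open>X \<in> S\<close>] by (elim exE conjE)
    obtain e where e: "e > 0" "\<forall>Y\<in>L1 M. L1_norm M (\<lambda>\<omega>. Y \<omega> - X \<omega>) < e \<longrightarrow> Y \<in> T"
      using bspec[OF conjunct2[OF T[unfolded L1_open_def]] \<open>X \<in> T\<close>] by (elim exE conjE)
    show "\<exists>e>0. \<forall>Y\<in>L1 M. L1_norm M (\<lambda>\<omega>. Y \<omega> - X \<omega>) < e \<longrightarrow> Y \<in> S \<inter> T"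
      by (rule exI[of _ "min d e"]) (use d e in simp)
  qed
next
  fix \<U> assume U: "\<forall>U\<in>\<U>. L1_open M U"
  show "L1_open M (\<Union>\<U>)"
    unfolding L1_open_def
  proof (intro conjI ballI)
    show "\<Union>\<U> \<subseteq> L1 M" using U by (auto simp: L1_open_def)
    fix X assume "X \<in> \<Union>\<U>"
    then obtain V where V: "V \<in> \<U>" "X \<in> V" by auto
    then have "L1_open M V" using U by simp
    obtain e where e: "e > 0" "\<forall>Y\<in>L1 M. L1_norm M (\<lambda>\<omega>. Y \<omega> - X \<omega>) < e \<longrightarrow> Y \<in> V"
      using bspec[OF conjunct2[OF \<open>L1_open M V\<close>[unfolded L1_open_def]] V(2)] by (elim exE conjE)
    show "\<exists>e>0. \<forall>Y\<in>L1 M. L1_norm M (\<lambda>\<omega>. Y \<omega> - X \<omega>) < e \<longrightarrow> Y \<in> \<Union>\<U>"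
    proof (intro exI conjI ballI impI)
      show "e > 0" by fact
      fix Y assume "Y \<in> L1 M" "L1_norm M (\<lambda>\<omega>. Y \<omega> - X \<omega>) < e"
      then have "Y \<in> V" using e(2) by simp
      then show "Y \<in> \<Union>\<U>" using V(1) by (rule UnionI[rotated])
    qed
  qed
qed

lemma openin_L1_topology: "openin (L1_topology M) U \<longleftrightarrow> L1_open M U"
  by (simp add: L1_topology_def istopology_L1_open)

lemma topspace_L1_topology: "topspace (L1_topology M) = L1 M"
proof -
  have "L1_open M (L1 M)"
    unfolding L1_open_def by (intro conjI ballI exI[of _ 1]) auto
  moreover have "U \<subseteq> L1 M" if "L1_open M U" for U
    using that by (simp add: L1_open_def)
  ultimately show ?thesis
    unfolding topspace_def openin_L1_topology by blast
qed

definition finite_partitions :: "'a measure \<Rightarrow> 'a set set set" where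
  "finite_partitions M = {\<pi>. finite \<pi> \<and> partition_on (space M) \<pi> \<and>
     (\<forall>A\<in>\<pi>. A \<in> sets M \<and> measure M A > 0)}"

definition partition_cond_exp :: "'a measure \<Rightarrow> 'a set set \<Rightarrow> ('a \<Rightarrow> real) \<Rightarrow> 'a \<Rightarrow> real" where
  "partition_cond_exp M \<pi> X = real_cond_exp M (sigma (space M) \<pi>) X"

text \<open>
  Functions on \<open>[0,\<infinity>)\<close> are represented by functions on the reals, whose values at negative
  arguments are irrelevant. On \<open>[0,\<infinity>)\<close>, left-continuity is a condition at positive points only.
\<close>

definition orlicz_function :: "(real \<Rightarrow> ennreal) \<Rightarrow> bool" where
  "orlicz_function G \<longleftrightarrow>
     (\<forall>x>0. (G \<longlongrightarrow> G x) (at_left x)) \<and>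
     (\<forall>x\<ge>0. \<forall>y\<ge>0. \<forall>t\<in>{0<..<1}.
        G (t * x + (1 - t) * y) \<le> ennreal t * G x + ennreal (1 - t) * G y) \<and>
     G 0 = 0 \<and> (G \<longlongrightarrow> 0) (at_right 0) \<and> (G \<longlongrightarrow> \<infinity>) at_top"

definition real_valued_orlicz_function :: "(real \<Rightarrow> ennreal) \<Rightarrow> bool" where
  "real_valued_orlicz_function G \<longleftrightarrow> orlicz_function G \<and> (\<forall>x\<ge>0. G x < \<infinity>)"

definition orlicz_inverse :: "(real \<Rightarrow> ennreal) \<Rightarrow> ennreal \<Rightarrow> real" where
  "orlicz_inverse G y = Sup {t. 0 < t \<and> G t \<le> y}"

definition luxemburg_norm :: "'a measure \<Rightarrow> (real \<Rightarrow> ennreal) \<Rightarrow> ('a \<Rightarrow> real) \<Rightarrow> ennreal" where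
  "luxemburg_norm M G X = Inf {ennreal l |l. 0 < l \<and> (\<integral>\<^sup>+\<omega>. G (\<bar>X \<omega>\<bar> / l) \<partial>M) \<le> 1}"

definition orlicz_space :: "'a measure \<Rightarrow> (real \<Rightarrow> ennreal) \<Rightarrow> ('a \<Rightarrow> real) set" where
  "orlicz_space M G = {X \<in> L1 M. \<exists>c>0. (\<integral>\<^sup>+\<omega>. G (c * \<bar>X \<omega>\<bar>) \<partial>M) < \<infinity>}"

definition admissible_F :: "(real \<Rightarrow> ereal) \<Rightarrow> bool" where
  "admissible_F F \<longleftrightarrow>
     (\<forall>x\<ge>0. F x > -\<infinity>) \<and>
     (\<forall>x>0. (F \<longlongrightarrow> F x) (at_left x)) \<and>
     mono_on {0..} F \<and>
     (\<forall>x\<ge>0. \<forall>y\<ge>0. \<forall>t\<in>{0<..<1}.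
        F (t * x + (1 - t) * y) \<le> ereal t * F x + ereal (1 - t) * F y) \<and>
     (\<exists>x\<ge>0. F x \<noteq> \<infinity>) \<and>
     (F \<longlongrightarrow> \<infinity>) at_top"

definition admissible_H :: "(real \<Rightarrow> real) \<Rightarrow> bool" where
  "admissible_H H \<longleftrightarrow>
     (\<forall>x. H x \<ge> 0) \<and> mono H \<and> convex_on UNIV H \<and> filterlim H at_top at_top"

definition extend_F :: "(real \<Rightarrow> ereal) \<Rightarrow> ennreal \<Rightarrow> ereal" where
  "extend_F F y = (if y = \<infinity> then \<infinity> else F (enn2real y))"

definition transform_domain ::
    "'a measure \<Rightarrow> (real \<Rightarrow> ennreal) \<Rightarrow> (real \<Rightarrow> real) \<Rightarrow> ('a \<Rightarrow> real) set" where
  "transform_domain M G H = {X \<in> L1 M. \<forall>s. (\<lambda>\<omega>. H (s - X \<omega>)) \<in> orlicz_space M G}"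

text \<open>
  On \<open>transform_domain\<close> the Luxemburg norms below are finite, so \<open>enn2real\<close> does not lose
  information there; the transform is only applied to elements of that set
  (see \<open>luxemburg_norm_finite\<close> and \<open>partition_cond_exp_in_transform_domain\<close>).
\<close>

definition norm_transform ::
    "'a measure \<Rightarrow> (real \<Rightarrow> ereal) \<Rightarrow> (real \<Rightarrow> ennreal) \<Rightarrow> (real \<Rightarrow> real) \<Rightarrow> ('a \<Rightarrow> real) \<Rightarrow> ereal" where
  "norm_transform M F G H X =
     (INF s::real. F (enn2real (luxemburg_norm M G (\<lambda>\<omega>. H (s - X \<omega>)))) - ereal s)"

definition extended_transform ::
    "'a measure \<Rightarrow> (real \<Rightarrow> ereal) \<Rightarrow> (real \<Rightarrow> ennreal) \<Rightarrow> (real \<Rightarrow> real) \<Rightarrow> ('a \<Rightarrow> real) \<Rightarrow> ereal" where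
  "extended_transform M F G H X =
     (SUP \<pi>\<in>finite_partitions M. norm_transform M F G H (partition_cond_exp M \<pi> X))"

definition L1_lower_semicontinuous :: "'a measure \<Rightarrow> (('a \<Rightarrow> real) \<Rightarrow> ereal) \<Rightarrow> bool" where
  "L1_lower_semicontinuous M \<rho> \<longleftrightarrow>
     (\<forall>l::real. closedin (L1_topology M) {X \<in> L1 M. \<rho> X \<le> ereal l})"

text \<open>In \<^typ>\<open>ereal\<close>, the sum of \<open>\<infinity>\<close> and \<open>-\<infinity>\<close> is \<open>\<infinity>\<close>, the usual convention for convexity.\<close>

definition L1_convex :: "'a measure \<Rightarrow> (('a \<Rightarrow> real) \<Rightarrow> ereal) \<Rightarrow> bool" where
  "L1_convex M \<rho> \<longleftrightarrow> (\<forall>X\<in>L1 M. \<forall>Y\<in>L1 M. \<forall>t\<in>{0<..<1::real}.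
     \<rho> (\<lambda>\<omega>. t * X \<omega> + (1 - t) * Y \<omega>) \<le> ereal t * \<rho> X + ereal (1 - t) * \<rho> Y)"

text \<open>
  Since the order is almost sure, this property forces \<open>\<rho>\<close> to agree on almost surely equal
  functions, so that \<open>\<rho>\<close> is well defined on classes.
\<close>

definition L1_monotone :: "'a measure \<Rightarrow> (('a \<Rightarrow> real) \<Rightarrow> ereal) \<Rightarrow> bool" where
  "L1_monotone M \<rho> \<longleftrightarrow> (\<forall>X\<in>L1 M. \<forall>Y\<in>L1 M. (AE \<omega> in M. X \<omega> \<ge> Y \<omega>) \<longrightarrow> \<rho> X \<le> \<rho> Y)"

definition L1_cash_additive :: "'a measure \<Rightarrow> (('a \<Rightarrow> real) \<Rightarrow> ereal) \<Rightarrow> bool" where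
  "L1_cash_additive M \<rho> \<longleftrightarrow> (\<forall>X\<in>L1 M. \<forall>s::real. \<rho> (\<lambda>\<omega>. X \<omega> + s) = \<rho> X - ereal s)"

definition L1_dilatation_monotone :: "'a measure \<Rightarrow> (('a \<Rightarrow> real) \<Rightarrow> ereal) \<Rightarrow> bool" where
  "L1_dilatation_monotone M \<rho> \<longleftrightarrow>
     (\<forall>X\<in>L1 M. \<forall>\<pi>\<in>finite_partitions M. \<rho> (partition_cond_exp M \<pi> X) \<le> \<rho> X)"

lemma orlicz_function_scale_le:
  assumes G: "orlicz_function G" and "0 \<le> t" "t \<le> 1" and x: "0 \<le> x"
  shows "G (t * x) \<le> ennreal t * G x"
proof (cases "t = 0 \<or> t = 1")
  case True then show ?thesis using G by (auto simp: orlicz_function_def)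
next
  case False
  then have t: "t \<in> {0<..<1}" using assms by auto
  have "G (t * x + (1 - t) * 0) \<le> ennreal t * G x + ennreal (1 - t) * G 0"
    using G[unfolded orlicz_function_def, THEN conjunct2, THEN conjunct1, rule_format, of x 0 t] t x
    by simp
  then show ?thesis using G by (simp add: orlicz_function_def)
qed

lemma orlicz_function_mono:
  assumes G: "orlicz_function G" and x: "0 \<le> x" and xy: "x \<le> y"
  shows "G x \<le> G y"
proof (cases "y = 0")
  case True then show ?thesis using x xy by simp
next
  case False
  then have y: "y > 0" using x xy by simp
  have "G (x / y * y) \<le> ennreal (x / y) * G y"
    by (rule orlicz_function_scale_le) (use G x xy y in \<open>auto simp: divide_simps\<close>)
  also have "\<dots> \<le> 1 * G y"
    using x xy y by (intro mult_right_mono) (auto simp: ennreal_le_1)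
  finally show ?thesis using y by simp
qed

lemma orlicz_function_measurable:
  assumes G: "orlicz_function G"
  shows "(\<lambda>x. G \<bar>x\<bar>) \<in> borel_measurable borel"
proof -
  have "(\<lambda>x. G (max 0 x)) \<in> borel_measurable borel"
  proof (rule borel_measurableI_le)
    fix a
    have "is_interval {x. G (max 0 x) \<le> a}"
      unfolding is_interval_1
    proof (intro ballI allI impI)
      fix u v x :: real
      assume v: "v \<in> {x. G (max 0 x) \<le> a}" and x: "u \<le> x \<and> x \<le> v"
      have "G (max 0 x) \<le> G (max 0 v)"
        using x by (intro orlicz_function_mono[OF G]) auto
      with v show "x \<in> {x. G (max 0 x) \<le> a}" by simp
    qed
    then show "{x \<in> space borel. G (max 0 x) \<le> a} \<in> sets borel"
      by (simp add: real_interval_borel_measurable)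
  qed
  then have "(\<lambda>x::real. G (max 0 \<bar>x\<bar>)) \<in> borel_measurable borel"
    by (rule measurable_compose[rotated]) simp
  then show ?thesis by simp
qed

lemma sigma_partition_measurable_const:
  fixes f :: "'a \<Rightarrow> real"
  assumes p: "partition_on \<Omega> \<pi>" and f: "f \<in> borel_measurable (sigma \<Omega> \<pi>)"
    and A: "A \<in> \<pi>" and x: "x \<in> A" and y: "y \<in> A"
  shows "f x = f y"
proof -
  have sub: "\<pi> \<subseteq> Pow \<Omega>" using p by (auto simp: partition_on_def)
  have *: "A \<subseteq> B \<or> A \<inter> B = {}" if "B \<in> sigma_sets \<Omega> \<pi>" for B
    using that
  proof induction
    case (Basic B) then show ?case
      using disjointD[OF partition_onD2[OF p] A] by blast
  next
    case (Compl B) then show ?case using A sub by auto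
  qed auto
  have "f -` {f x} \<inter> space (sigma \<Omega> \<pi>) \<in> sets (sigma \<Omega> \<pi>)"
    using f by (rule measurable_sets) auto
  then have "f -` {f x} \<inter> \<Omega> \<in> sigma_sets \<Omega> \<pi>"
    using sub by (simp add: space_measure_of_conv sets_measure_of)
  from *[OF this] show ?thesis using x y A sub by auto
qed

lemma transform_domain_bounded:
  assumes "prob_space M" and G: "real_valued_orlicz_function G" and H: "admissible_H H"
    and Ym: "Y \<in> borel_measurable M" and bd: "\<And>\<omega>. \<omega> \<in> space M \<Longrightarrow> \<bar>Y \<omega>\<bar> \<le> K"
  shows "Y \<in> transform_domain M G H"
proof -
  interpret prob_space M by fact
  have Hc: "continuous_on UNIV H"
    using H by (auto simp: admissible_H_def intro: convex_on_continuous)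
  have Hm: "H \<in> borel_measurable borel"
    using Hc by (rule borel_measurable_continuous_onI)
  have Yi: "integrable M Y"
    by (rule integrable_const_bound[of _ K]) (use Ym bd in auto)
  have "(\<lambda>\<omega>. H (s - Y \<omega>)) \<in> orlicz_space M G" for s
  proof -
    define L where "L = H (s + K) + 1"
    have L: "L > 0" using H by (auto simp: L_def admissible_H_def intro: add_nonneg_pos)
    have H0: "0 \<le> H x" for x using H by (auto simp: admissible_H_def)
    have HL: "H (s - Y \<omega>) \<le> L" if "\<omega> \<in> space M" for \<omega>
    proof -
      have "H (s - Y \<omega>) \<le> H (s + K)"
        using H bd[OF that] by (auto simp: admissible_H_def intro: monoD)
      then show ?thesis by (simp add: L_def)
    qed
    have i: "integrable M (\<lambda>\<omega>. H (s - Y \<omega>))"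
      by (rule integrable_const_bound[of _ L])
         (use Ym Hm HL H0 in \<open>auto intro!: measurable_compose[OF _ Hm]\<close>)
    have Gle: "G t \<le> G 1" if "0 \<le> t" "t \<le> 1" for t
      using G that by (intro orlicz_function_mono) (auto simp: real_valued_orlicz_function_def)
    have "(\<integral>\<^sup>+\<omega>. G (1 / L * \<bar>H (s - Y \<omega>)\<bar>) \<partial>M) \<le> (\<integral>\<^sup>+\<omega>. G 1 \<partial>M)"
      using HL H0 L by (intro nn_integral_mono Gle) (auto simp: divide_simps)
    also have "\<dots> = G 1" by (simp add: emeasure_space_1)
    also have "\<dots> < \<infinity>" using G by (simp add: real_valued_orlicz_function_def)
    finally show ?thesis using i L unfolding orlicz_space_def L1_def
      by (auto intro!: exI[of _ "1 / L"])
  qed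
  then show ?thesis using Yi by (simp add: transform_domain_def L1_def)
qed

lemma partition_cond_exp_in_transform_domain:
  assumes M: "prob_space M" and G: "real_valued_orlicz_function G" and H: "admissible_H H"
    and pi: "\<pi> \<in> finite_partitions M"
  shows "partition_cond_exp M \<pi> X \<in> transform_domain M G H"
proof -
  let ?N = "sigma (space M) \<pi>" and ?Y = "partition_cond_exp M \<pi> X"
  have p: "partition_on (space M) \<pi>" "finite \<pi>" and ps: "\<pi> \<subseteq> sets M"
    using pi by (auto simp: finite_partitions_def)
  have sub: "\<pi> \<subseteq> Pow (space M)" using p by (auto simp: partition_on_def)
  have N: "?Y \<in> borel_measurable ?N"
    by (simp add: partition_cond_exp_def)
  have "subalgebra M ?N"
    using sub ps by (auto simp: subalgebra_def space_measure_of_conv sets_measure_of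
        intro: sets.sigma_sets_subset[THEN subsetD])
  then have Ym: "?Y \<in> borel_measurable M" using N by (rule measurable_from_subalg)
  define a where "a A = ?Y (SOME x. x \<in> A)" for A
  have "\<bar>?Y x\<bar> \<le> (\<Sum>A\<in>\<pi>. \<bar>a A\<bar>)" if "x \<in> space M" for x
  proof -
    have "x \<in> \<Union>\<pi>" using p that by (simp add: partition_on_def)
    then obtain A where A: "A \<in> \<pi>" "x \<in> A" by auto
    have "?Y x = a A" unfolding a_def
      by (rule sigma_partition_measurable_const[OF p(1) N A(1) A(2)]) (use A in \<open>auto intro: someI\<close>)
    then show ?thesis using A p member_le_sum[of A \<pi> "\<lambda>A. \<bar>a A\<bar>"] by auto
  qed
  with transform_domain_bounded[OF M G H Ym] show ?thesis by blast
qed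

lemma luxemburg_norm_finite:
  assumes G: "orlicz_function G" and X: "X \<in> orlicz_space M G"
  shows "luxemburg_norm M G X < \<infinity>"
proof -
  obtain c where c: "c > 0" and fin: "(\<integral>\<^sup>+\<omega>. G (c * \<bar>X \<omega>\<bar>) \<partial>M) < \<infinity>"
    using X by (auto simp: orlicz_space_def)
  have Xm: "X \<in> borel_measurable M" using X by (auto simp: orlicz_space_def L1_def)
  have "(\<lambda>\<omega>. G \<bar>c * X \<omega>\<bar>) \<in> borel_measurable M"
    by (rule measurable_compose[OF _ orlicz_function_measurable[OF G]]) (use Xm in simp)
  then have Gm: "(\<lambda>\<omega>. G (c * \<bar>X \<omega>\<bar>)) \<in> borel_measurable M"
    using c by (simp add: abs_mult)
  define I where "I = enn2real (\<integral>\<^sup>+\<omega>. G (c * \<bar>X \<omega>\<bar>) \<partial>M)"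
  have I: "(\<integral>\<^sup>+\<omega>. G (c * \<bar>X \<omega>\<bar>) \<partial>M) = ennreal I" "I \<ge> 0" using fin by (auto simp: I_def)
  define t where "t = 1 / (I + 2)"
  have t: "0 < t" "t < 1" "t * I \<le> 1" using I(2) by (auto simp: t_def divide_simps)
  have "(\<integral>\<^sup>+\<omega>. G (\<bar>X \<omega>\<bar> / (1 / (t * c))) \<partial>M) \<le> (\<integral>\<^sup>+\<omega>. ennreal t * G (c * \<bar>X \<omega>\<bar>) \<partial>M)"
  proof (rule nn_integral_mono)
    fix \<omega>
    show "G (\<bar>X \<omega>\<bar> / (1 / (t * c))) \<le> ennreal t * G (c * \<bar>X \<omega>\<bar>)"
      using orlicz_function_scale_le[OF G, of t "c * \<bar>X \<omega>\<bar>"] t c by (simp add: mult_ac)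
  qed
  also have "\<dots> = ennreal (t * I)"
    using t I by (simp add: nn_integral_cmult[OF Gm] ennreal_mult)
  also have "\<dots> \<le> 1" using t by (simp add: ennreal_le_1)
  finally have "luxemburg_norm M G X \<le> ennreal (1 / (t * c))"
    unfolding luxemburg_norm_def using t c by (intro Inf_lower) auto
  then show ?thesis by (simp add: order_le_less_trans)
qed

end

theory Submission
  imports Defs
begin

text \<open>
  Let \<open>Tbar\<close> be the functional given by the infimum formula. Conditional Jensen, applied to the
  convex function \<open>x \<mapsto> G (H (s - x) / l)\<close>, shows that \<open>Tbar\<close> decreases under conditional expectations,
  and it coincides with the norm transform on bounded functions. The main point is lower
  semicontinuity along \<open>L\<^sup>1\<close>-convergent sequences: Jensen bounds the Luxemburg norm of \<open>H (s - X)\<close>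
  from below by that of the constant \<open>H (s - E X)\<close>, so the growth hypothesis confines near-optimal \<open>s\<close>
  to a bounded interval; one extracts a convergent subsequence and applies Fatou's lemma to the
  Luxemburg norm. As every \<open>X\<close> in \<open>L\<^sup>1\<close> is a limit of conditional expectations along finite partitions,
  the supremum defining the extended transform equals \<open>Tbar X\<close>, and the remaining properties
  are read off the formula.
\<close>

section \<open>Jensen inequalities for nonnegative convex functions\<close>

text \<open>If the right side is infinite there is nothing to show; otherwise
  \<open>q (X \<omega>)\<close> is integrable and the almost sure conditional Jensen inequality can
  be integrated. Stated with nonnegative integrals, the inequality applies without any integrability
  of \<open>q (X \<omega>)\<close>.\<close>

lemma (in prob_space) nn_integral_convex_cond_exp_le:
  fixes q :: "real \<Rightarrow> real"
  assumes N: "subalgebra M N" and X: "integrable M X"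
    and q: "convex_on UNIV q" and q0: "\<And>x. 0 \<le> q x"
  shows "(\<integral>\<^sup>+\<omega>. q (real_cond_exp M N X \<omega>) \<partial>M) \<le> (\<integral>\<^sup>+\<omega>. q (X \<omega>) \<partial>M)"
proof (cases "(\<integral>\<^sup>+\<omega>. q (X \<omega>) \<partial>M) = \<infinity>")
  case False
  interpret finite_measure_subalgebra M N
    by unfold_locales (use N in auto)
  have qm: "q \<in> borel_measurable borel"
    using convex_on_continuous[OF _ q] by (intro borel_measurable_continuous_onI) auto
  have Xm: "X \<in> borel_measurable M" using X by auto
  have i: "integrable M (\<lambda>\<omega>. q (X \<omega>))"
    using False q0 measurable_compose[OF Xm qm]
    by (intro integrableI_nonneg) (auto simp: less_top)
  have "(\<integral>\<^sup>+\<omega>. q (real_cond_exp M N X \<omega>) \<partial>M) \<le> (\<integral>\<^sup>+\<omega>. real_cond_exp M N (\<lambda>\<omega>. q (X \<omega>)) \<omega> \<partial>M)"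
    using real_cond_exp_jensens_inequality(2)[OF X, where I = UNIV and q = q] i q qm
    by (intro nn_integral_mono_AE) (auto simp: ennreal_leI)
  also have "\<dots> = ennreal (\<integral>\<omega>. real_cond_exp M N (\<lambda>\<omega>. q (X \<omega>)) \<omega> \<partial>M)"
    using real_cond_exp_int(1)[OF i] real_cond_exp_pos[of "\<lambda>\<omega>. q (X \<omega>)"] i q0
    by (intro nn_integral_eq_integral) auto
  also have "\<dots> = (\<integral>\<^sup>+\<omega>. q (X \<omega>) \<partial>M)"
    using real_cond_exp_int(2)[OF i] nn_integral_eq_integral[OF i] q0 by simp
  finally show ?thesis .
qed simp

lemma (in prob_space) convex_expectation_le_nn_integral:
  fixes q :: "real \<Rightarrow> real"
  assumes X: "integrable M X" and q: "convex_on UNIV q" and q0: "\<And>x. 0 \<le> q x"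
  shows "ennreal (q (expectation X)) \<le> (\<integral>\<^sup>+\<omega>. q (X \<omega>) \<partial>M)"
proof (cases "(\<integral>\<^sup>+\<omega>. q (X \<omega>) \<partial>M) = \<infinity>")
  case False
  have qm: "q \<in> borel_measurable borel"
    using convex_on_continuous[OF _ q] by (intro borel_measurable_continuous_onI) auto
  have Xm: "X \<in> borel_measurable M" using X by auto
  have i: "integrable M (\<lambda>\<omega>. q (X \<omega>))"
    using False q0 measurable_compose[OF Xm qm]
    by (intro integrableI_nonneg) (auto simp: less_top)
  have "q (expectation X) \<le> expectation (\<lambda>\<omega>. q (X \<omega>))"
    using jensens_inequality[OF X, where I = UNIV and q = q] i q by auto
  then show ?thesis
    using nn_integral_eq_integral[OF i] q0 by (simp add: ennreal_leI)
qed simp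

section \<open>Approximation in L1 by conditional expectations on finite partitions\<close>

lemma subalgebra_sigma_partition:
  assumes "\<pi> \<in> finite_partitions M"
  shows "subalgebra M (sigma (space M) \<pi>)"
proof -
  have "\<pi> \<subseteq> Pow (space M)" "\<pi> \<subseteq> sets M"
    using assms by (auto simp: finite_partitions_def partition_on_def)
  then show ?thesis
    by (auto simp: subalgebra_def space_measure_of_conv sets_measure_of
        intro: sets.sigma_sets_subset[THEN subsetD])
qed

lemma (in prob_space) partition_cond_exp_L1:
  assumes "\<pi> \<in> finite_partitions M" and "X \<in> L1 M"
  shows "partition_cond_exp M \<pi> X \<in> L1 M"
proof -
  interpret finite_measure_subalgebra M "sigma (space M) \<pi>"
    by unfold_locales (use subalgebra_sigma_partition[OF assms(1)] in auto)
  show ?thesis using assms(2) real_cond_exp_int(1) by (simp add: L1_def partition_cond_exp_def)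
qed

text \<open>Members of a partition in \<open>finite_partitions\<close> have positive probability, so
  level sets of a simple function qualify only after its null values are removed. There are finitely
  many of them, so together they cover a null set, on which the function is redefined by a value of
  positive probability.\<close>

lemma (in prob_space) simple_function_AE_eq_positive_fibres:
  fixes f :: "'a \<Rightarrow> real"
  assumes f: "simple_function M f"
  obtains g where "simple_function M g" "AE \<omega> in M. g \<omega> = f \<omega>"
    "\<And>\<omega>. \<omega> \<in> space M \<Longrightarrow> 0 < prob (g -` {g \<omega>} \<inter> space M)"
proof -
  have fin: "finite (f ` space M)" and sets: "f -` {y} \<inter> space M \<in> sets M" for y
    using f by (auto simp: simple_function_def intro: simple_functionD)
  define N where "N = {y \<in> f ` space M. prob (f -` {y} \<inter> space M) = 0}"
  have N: "AE \<omega> in M. f \<omega> \<notin> N"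
  proof -
    have "AE \<omega> in M. \<forall>y\<in>N. \<omega> \<notin> f -` {y} \<inter> space M"
    proof (rule AE_finite_allI)
      show "finite N" using fin by (simp add: N_def)
      fix y assume "y \<in> N"
      then have "f -` {y} \<inter> space M \<in> null_sets M"
        using sets by (auto simp: N_def emeasure_eq_measure null_sets_def)
      then show "AE \<omega> in M. \<omega> \<notin> f -` {y} \<inter> space M" by (rule AE_not_in)
    qed
    then show ?thesis using AE_space by eventually_elim auto
  qed
  \<comment> \<open>Otherwise \<open>f\<close> takes values in \<open>N\<close> everywhere and
    almost nowhere, which is impossible on a probability space.\<close>
  have "\<exists>x\<in>space M. f x \<notin> N"
  proof (rule ccontr)
    assume "\<not> ?thesis"
    then have "AE \<omega> in M. False" using N AE_space by (auto elim: AE_mp)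
    then show False by simp
  qed
  then obtain x where x: "x \<in> space M" "f x \<notin> N" by auto
  define g where "g \<omega> = (if f \<omega> \<in> N then f x else f \<omega>)" for \<omega>
  have g: "simple_function M g"
    unfolding g_def by (rule simple_function_compose1[OF f])
  show ?thesis
  proof
    show "simple_function M g" by fact
    show "AE \<omega> in M. g \<omega> = f \<omega>" using N by eventually_elim (simp add: g_def)
    fix \<omega> assume w: "\<omega> \<in> space M"
    have nN: "g \<omega> \<notin> N" "g \<omega> \<in> f ` space M" using x w by (auto simp: g_def)
    have "0 < prob (f -` {g \<omega>} \<inter> space M)"
      using nN by (auto simp: N_def zero_less_measure_iff)
    \<comment> \<open>Values outside \<open>N\<close> are left unchanged, so a fibre of
      \<open>g\<close> contains the fibre of \<open>f\<close> over the same value.\<close>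
    also have "\<dots> \<le> prob (g -` {g \<omega>} \<inter> space M)"
      using nN simple_functionD(2)[OF g] by (intro finite_measure_mono) (auto simp: g_def)
    finally show "0 < prob (g -` {g \<omega>} \<inter> space M)" .
  qed
qed

text \<open>Let \<open>Z\<close> be simple within \<open>e / 2\<close> of \<open>X\<close>, and let
  \<open>\<pi>\<close> consist of its level sets. Conditioning on \<open>\<pi>\<close> fixes
  \<open>Z\<close>, so the error is E[X - Z | \<pi>] - (X - Z). Conditional expectation contracts
  the L1 norm, by Jensen for the absolute value, so the error is below
  \<open>e / 2 + e / 2\<close>.\<close>

lemma (in prob_space) partition_cond_exp_approx:
  assumes X: "X \<in> L1 M" and e: "0 < e"
  obtains \<pi> where "\<pi> \<in> finite_partitions M"
    "L1_norm M (\<lambda>\<omega>. partition_cond_exp M \<pi> X \<omega> - X \<omega>) < e"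
proof -
  have Xi: "integrable M X" using X by (simp add: L1_def)
  \<comment> \<open>Unfolding the Bochner integral yields simple functions \<open>s i\<close>
    converging to \<open>X\<close> in L1.\<close>
  obtain s where s: "\<And>i. Bochner_Integration.simple_bochner_integrable M (s i)"
    "(\<lambda>i. \<integral>\<^sup>+\<omega>. norm (X \<omega> - s i \<omega>) \<partial>M) \<longlonglongrightarrow> 0"
    using Xi by (auto simp: integrable.simps has_bochner_integral.simps)
  have "\<forall>\<^sub>F i in sequentially. (\<integral>\<^sup>+\<omega>. norm (X \<omega> - s i \<omega>) \<partial>M) < ennreal (e / 2)"
    using order_tendstoD(2)[OF s(2)] e by simp
  then obtain i where i: "(\<integral>\<^sup>+\<omega>. norm (X \<omega> - s i \<omega>) \<partial>M) < ennreal (e / 2)"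
    by (auto simp: eventually_sequentially)
  have "simple_function M (s i)" using s(1)[of i] by (auto elim: Bochner_Integration.simple_bochner_integrable.cases)
  then obtain Z where Z: "simple_function M Z" "AE \<omega> in M. Z \<omega> = s i \<omega>"
    "\<And>\<omega>. \<omega> \<in> space M \<Longrightarrow> 0 < prob (Z -` {Z \<omega>} \<inter> space M)"
    by (rule simple_function_AE_eq_positive_fibres) blast
  define \<pi> where "\<pi> = (\<lambda>z. Z -` {z} \<inter> space M) ` (Z ` space M)"
  have sub: "\<pi> \<subseteq> Pow (space M)" by (auto simp: \<pi>_def)
  have pi: "\<pi> \<in> finite_partitions M"
    unfolding finite_partitions_def partition_on_def
    using Z simple_functionD[OF Z(1)] by (auto simp: \<pi>_def disjoint_def)
  interpret finite_measure_subalgebra M "sigma (space M) \<pi>"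
    by unfold_locales (use subalgebra_sigma_partition[OF pi] in auto)
  have Zm: "Z \<in> borel_measurable (sigma (space M) \<pi>)"
  proof (rule borel_measurable_simple_function, unfold simple_function_def, intro conjI ballI)
    show "finite (Z ` space (sigma (space M) \<pi>))"
      using simple_functionD(1)[OF Z(1)] by (simp add: space_measure_of_conv)
    fix z assume "z \<in> Z ` space (sigma (space M) \<pi>)"
    then have "Z -` {z} \<inter> space M \<in> \<pi>" by (auto simp: \<pi>_def space_measure_of_conv)
    then show "Z -` {z} \<inter> space (sigma (space M) \<pi>) \<in> sets (sigma (space M) \<pi>)"
      using sub by (auto simp: space_measure_of_conv sets_measure_of)
  qed
  have ZX: "(\<integral>\<^sup>+\<omega>. \<bar>X \<omega> - Z \<omega>\<bar> \<partial>M) < ennreal (e / 2)"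
  proof -
    have "(\<integral>\<^sup>+\<omega>. \<bar>X \<omega> - Z \<omega>\<bar> \<partial>M) = (\<integral>\<^sup>+\<omega>. norm (X \<omega> - s i \<omega>) \<partial>M)"
      by (rule nn_integral_cong_AE) (use Z(2) in \<open>eventually_elim; simp\<close>)
    then show ?thesis using i by simp
  qed
  have Xm[measurable]: "X \<in> borel_measurable M" and Zm'[measurable]: "Z \<in> borel_measurable M"
    using Xi borel_measurable_simple_function[OF Z(1)] by auto
  have D: "integrable M (\<lambda>\<omega>. X \<omega> - Z \<omega>)"
    using ZX by (intro integrableI_bounded) (auto intro: less_trans)
  have Zi: "integrable M Z"
    using Bochner_Integration.integrable_diff[OF Xi D] by simp
  have cm[measurable]: "real_cond_exp M (sigma (space M) \<pi>) Y \<in> borel_measurable M" for Y by simp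
  have "(\<integral>\<^sup>+\<omega>. \<bar>partition_cond_exp M \<pi> X \<omega> - X \<omega>\<bar> \<partial>M)
      \<le> (\<integral>\<^sup>+\<omega>. ennreal \<bar>real_cond_exp M (sigma (space M) \<pi>) (\<lambda>\<omega>. X \<omega> - Z \<omega>) \<omega>\<bar> + ennreal \<bar>X \<omega> - Z \<omega>\<bar> \<partial>M)"
  proof (rule nn_integral_mono_AE)
    show "AE \<omega> in M. ennreal \<bar>partition_cond_exp M \<pi> X \<omega> - X \<omega>\<bar>
      \<le> ennreal \<bar>real_cond_exp M (sigma (space M) \<pi>) (\<lambda>\<omega>. X \<omega> - Z \<omega>) \<omega>\<bar> + ennreal \<bar>X \<omega> - Z \<omega>\<bar>"
      using real_cond_exp_diff[OF Xi Zi] real_cond_exp_F_meas[OF Zi Zm]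
      by eventually_elim (auto simp: partition_cond_exp_def ennreal_plus[symmetric] simp del: ennreal_plus intro!: ennreal_leI)
  qed
  also have "\<dots> = (\<integral>\<^sup>+\<omega>. ennreal \<bar>real_cond_exp M (sigma (space M) \<pi>) (\<lambda>\<omega>. X \<omega> - Z \<omega>) \<omega>\<bar> \<partial>M)
      + (\<integral>\<^sup>+\<omega>. ennreal \<bar>X \<omega> - Z \<omega>\<bar> \<partial>M)"
    by (rule nn_integral_add) auto
  also have "\<dots> \<le> (\<integral>\<^sup>+\<omega>. ennreal \<bar>X \<omega> - Z \<omega>\<bar> \<partial>M) + (\<integral>\<^sup>+\<omega>. ennreal \<bar>X \<omega> - Z \<omega>\<bar> \<partial>M)"
    by (intro add_right_mono nn_integral_convex_cond_exp_le subalg D)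
       (use convex_on_dist[of UNIV "0::real"] in \<open>auto simp: dist_real_def\<close>)
  also have "\<dots> < ennreal (e / 2) + ennreal (e / 2)"
    by (rule add_strict_mono[OF ZX ZX])
  also have "\<dots> = ennreal e" using e by (simp flip: ennreal_plus)
  finally have "(\<integral>\<^sup>+\<omega>. \<bar>partition_cond_exp M \<pi> X \<omega> - X \<omega>\<bar> \<partial>M) < ennreal e" .
  moreover have "(\<integral>\<^sup>+\<omega>. \<bar>partition_cond_exp M \<pi> X \<omega> - X \<omega>\<bar> \<partial>M)
      = ennreal (L1_norm M (\<lambda>\<omega>. partition_cond_exp M \<pi> X \<omega> - X \<omega>))"
    unfolding L1_norm_def using partition_cond_exp_L1[OF pi X] Xi
    by (intro nn_integral_eq_integral) (auto simp: L1_def)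
  ultimately have "L1_norm M (\<lambda>\<omega>. partition_cond_exp M \<pi> X \<omega> - X \<omega>) < e"
    using e by (simp add: ennreal_less_iff L1_norm_def)
  then show ?thesis using that pi by blast
qed

section \<open>Luxemburg norm: comparison, convexity and lower semicontinuity\<close>

lemma luxemburg_norm_le:
  assumes "0 < l" and "(\<integral>\<^sup>+\<omega>. G (\<bar>X \<omega>\<bar> / l) \<partial>M) \<le> 1"
  shows "luxemburg_norm M G X \<le> ennreal l"
  unfolding luxemburg_norm_def using assms by (intro Inf_lower) auto

text \<open>Some admissible scale lies strictly below \<open>l\<close>, and since \<open>G\<close>
  is increasing, every scale above an admissible one is admissible.\<close>

lemma luxemburg_norm_lessD:
  assumes G: "orlicz_function G" and l: "luxemburg_norm M G X < ennreal l"
  shows "(\<integral>\<^sup>+\<omega>. G (\<bar>X \<omega>\<bar> / l) \<partial>M) \<le> 1"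
proof -
  obtain k where k: "0 < k" "(\<integral>\<^sup>+\<omega>. G (\<bar>X \<omega>\<bar> / k) \<partial>M) \<le> 1" "ennreal k < ennreal l"
    using l by (auto simp: luxemburg_norm_def Inf_less_iff)
  then have kl: "k < l" by (simp add: ennreal_less_iff)
  have "(\<integral>\<^sup>+\<omega>. G (\<bar>X \<omega>\<bar> / l) \<partial>M) \<le> (\<integral>\<^sup>+\<omega>. G (\<bar>X \<omega>\<bar> / k) \<partial>M)"
    using k(1) kl by (intro nn_integral_mono orlicz_function_mono[OF G]) (auto intro!: divide_left_mono)
  then show ?thesis using k(2) by simp
qed

text \<open>Every scale admissible for \<open>Y\<close> is admissible for \<open>X\<close>.
  Comparing integrals rather than values matters because Jensen gives no pointwise
  comparison.\<close>

lemma luxemburg_norm_le_norm: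
  assumes "\<And>l. 0 < l \<Longrightarrow> (\<integral>\<^sup>+\<omega>. G (\<bar>X \<omega>\<bar> / l) \<partial>M) \<le> (\<integral>\<^sup>+\<omega>. G (\<bar>Y \<omega>\<bar> / l) \<partial>M)"
  shows "luxemburg_norm M G X \<le> luxemburg_norm M G Y"
  unfolding luxemburg_norm_def
proof (rule Inf_superset_mono, clarify)
  fix l :: real assume "0 < l" "(\<integral>\<^sup>+\<omega>. G (\<bar>Y \<omega>\<bar> / l) \<partial>M) \<le> 1"
  with assms[of l] show "\<exists>k. ennreal l = ennreal k \<and> 0 < k \<and> (\<integral>\<^sup>+\<omega>. G (\<bar>X \<omega>\<bar> / k) \<partial>M) \<le> 1"
    by (auto intro!: exI[of _ l])
qed

lemma luxemburg_norm_mono_AE: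
  assumes G: "orlicz_function G" and XY: "AE \<omega> in M. \<bar>X \<omega>\<bar> \<le> \<bar>Y \<omega>\<bar>"
  shows "luxemburg_norm M G X \<le> luxemburg_norm M G Y"
proof (rule luxemburg_norm_le_norm, rule nn_integral_mono_AE)
  fix l :: real assume l: "0 < l"
  show "AE \<omega> in M. G (\<bar>X \<omega>\<bar> / l) \<le> G (\<bar>Y \<omega>\<bar> / l)"
    using XY
  proof eventually_elim
    case (elim \<omega>)
    then show ?case using l by (intro orlicz_function_mono[OF G] divide_right_mono) auto
  qed
qed

lemma orlicz_function_convexD:
  assumes "orlicz_function G" "0 \<le> x" "0 \<le> y" "0 < t" "t < 1"
  shows "G (t * x + (1 - t) * y) \<le> ennreal t * G x + ennreal (1 - t) * G y"
  using assms by (simp add: orlicz_function_def)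

lemma orlicz_function_compose_measurable:
  assumes "orlicz_function G" "X \<in> borel_measurable M" "0 < l"
  shows "(\<lambda>\<omega>. G (\<bar>X \<omega>\<bar> / l)) \<in> borel_measurable M"
proof -
  have "(\<lambda>\<omega>. G \<bar>X \<omega> / l\<bar>) \<in> borel_measurable M"
    by (rule measurable_compose[OF _ orlicz_function_measurable[OF assms(1)]]) (use assms(2) in simp)
  then show ?thesis using assms(3) by simp
qed

lemma luxemburg_norm_less_convex:
  assumes G: "orlicz_function G" and X: "X \<in> borel_measurable M" and Y: "Y \<in> borel_measurable M"
    and a: "luxemburg_norm M G X < ennreal a" and b: "luxemburg_norm M G Y < ennreal b"
    and t: "0 < t" "t < 1"
  shows "luxemburg_norm M G (\<lambda>\<omega>. t * X \<omega> + (1 - t) * Y \<omega>) \<le> ennreal (t * a + (1 - t) * b)"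
proof (rule luxemburg_norm_le)
  \<comment> \<open>A norm strictly below \<open>ennreal a\<close> forces \<open>a > 0\<close>,
    because \<open>ennreal\<close> sends nonpositive reals to 0.\<close>
  have ab: "0 < a" "0 < b" using a b by (auto intro: ccontr simp: ennreal_neg not_less)
  define l where "l = t * a + (1 - t) * b"
  \<comment> \<open>With this weight, (t |X| + (1 - t) |Y|) / l is the convex combination of |X| / a
    and |Y| / b with weights r and 1 - r, so convexity of \<open>G\<close> applies.\<close>
  define r where "r = t * a / l"
  show l: "0 < t * a + (1 - t) * b" using ab t by (intro add_pos_pos) auto
  then have l0: "l > 0" by (simp add: l_def)
  have r1: "1 - r = (1 - t) * b / l" using l0 by (simp add: r_def divide_simps) (simp add: l_def)
  have "0 < r" using l0 t ab by (simp add: r_def)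
  moreover have "0 < 1 - r" unfolding r1 using l0 t ab by simp
  ultimately have r: "0 < r" "r < 1" by auto
  have "G (\<bar>t * X \<omega> + (1 - t) * Y \<omega>\<bar> / l) \<le> ennreal r * G (\<bar>X \<omega>\<bar> / a) + ennreal (1 - r) * G (\<bar>Y \<omega>\<bar> / b)" for \<omega>
  proof -
    have "\<bar>t * X \<omega> + (1 - t) * Y \<omega>\<bar> \<le> t * \<bar>X \<omega>\<bar> + (1 - t) * \<bar>Y \<omega>\<bar>"
      using t by (intro order_trans[OF abs_triangle_ineq]) (simp add: abs_mult)
    then have "\<bar>t * X \<omega> + (1 - t) * Y \<omega>\<bar> / l \<le> (t * \<bar>X \<omega>\<bar> + (1 - t) * \<bar>Y \<omega>\<bar>) / l"
      using l0 by (intro divide_right_mono) auto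
    also have "\<dots> = r * (\<bar>X \<omega>\<bar> / a) + (1 - r) * (\<bar>Y \<omega>\<bar> / b)"
      using ab l0 unfolding r1 by (simp add: r_def add_divide_distrib)
    finally have "G (\<bar>t * X \<omega> + (1 - t) * Y \<omega>\<bar> / l) \<le> G (r * (\<bar>X \<omega>\<bar> / a) + (1 - r) * (\<bar>Y \<omega>\<bar> / b))"
      using l0 by (intro orlicz_function_mono[OF G]) auto
    also have "\<dots> \<le> ennreal r * G (\<bar>X \<omega>\<bar> / a) + ennreal (1 - r) * G (\<bar>Y \<omega>\<bar> / b)"
      using ab r by (intro orlicz_function_convexD[OF G]) auto
    finally show ?thesis .
  qed
  then have "(\<integral>\<^sup>+\<omega>. G (\<bar>t * X \<omega> + (1 - t) * Y \<omega>\<bar> / l) \<partial>M)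
      \<le> (\<integral>\<^sup>+\<omega>. ennreal r * G (\<bar>X \<omega>\<bar> / a) + ennreal (1 - r) * G (\<bar>Y \<omega>\<bar> / b) \<partial>M)"
    by (intro nn_integral_mono)
  also have "\<dots> = ennreal r * (\<integral>\<^sup>+\<omega>. G (\<bar>X \<omega>\<bar> / a) \<partial>M) + ennreal (1 - r) * (\<integral>\<^sup>+\<omega>. G (\<bar>Y \<omega>\<bar> / b) \<partial>M)"
    using orlicz_function_compose_measurable[OF G X ab(1)] orlicz_function_compose_measurable[OF G Y ab(2)]
    by (simp add: nn_integral_add nn_integral_cmult)
  also have "\<dots> \<le> ennreal r * 1 + ennreal (1 - r) * 1"
    using luxemburg_norm_lessD[OF G a] luxemburg_norm_lessD[OF G b] by (intro add_mono mult_left_mono) auto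
  also have "\<dots> = 1" using r by (simp flip: ennreal_plus)
  finally show "(\<integral>\<^sup>+\<omega>. G (\<bar>t * X \<omega> + (1 - t) * Y \<omega>\<bar> / (t * a + (1 - t) * b)) \<partial>M) \<le> 1"
    by (simp add: l_def)
qed

text \<open>The norms may vanish or fail to be admissible scales themselves, so both are raised by
  \<open>e\<close>; the convex combination then rises by exactly \<open>e\<close>.\<close>

lemma luxemburg_norm_convex:
  assumes G: "orlicz_function G" and X: "X \<in> borel_measurable M" and Y: "Y \<in> borel_measurable M"
    and a: "luxemburg_norm M G X = ennreal a" and b: "luxemburg_norm M G Y = ennreal b"
    and ab: "0 \<le> a" "0 \<le> b" and t: "0 < t" "t < 1"
  shows "luxemburg_norm M G (\<lambda>\<omega>. t * X \<omega> + (1 - t) * Y \<omega>) \<le> ennreal (t * a + (1 - t) * b)"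
proof (rule ennreal_le_epsilon)
  fix e :: real assume e: "0 < e"
  have "luxemburg_norm M G (\<lambda>\<omega>. t * X \<omega> + (1 - t) * Y \<omega>) \<le> ennreal (t * (a + e) + (1 - t) * (b + e))"
    using ab e unfolding a b by (intro luxemburg_norm_less_convex[OF G X Y _ _ t]) (auto simp: a b ennreal_less_iff)
  also have "t * (a + e) + (1 - t) * (b + e) = (t * a + (1 - t) * b) + e" by algebra
  finally show "luxemburg_norm M G (\<lambda>\<omega>. t * X \<omega> + (1 - t) * Y \<omega>) \<le> ennreal (t * a + (1 - t) * b) + ennreal e"
    using ab e t by (simp add: ennreal_plus)
qed

text \<open>An increasing convex function of a convex function is convex. Finiteness of
  \<open>G\<close> makes \<open>enn2real\<close> lossless, so real-valued Jensen and the continuity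
  of convex functions become available.\<close>

lemma real_valued_orlicz_compose_convex:
  assumes G: "real_valued_orlicz_function G" and h: "convex_on UNIV h" "\<And>x. 0 \<le> h x"
  shows "convex_on UNIV (\<lambda>x::real. enn2real (G (h x)))"
proof (rule convex_onI)
  have Go: "orlicz_function G" using G by (simp add: real_valued_orlicz_function_def)
  have fin: "G y = ennreal (enn2real (G y))" if "0 \<le> y" for y
    using G that by (simp add: real_valued_orlicz_function_def)
  fix t x y :: real assume t: "0 < t" "t < 1"
  have "G (h ((1 - t) *\<^sub>R x + t *\<^sub>R y)) \<le> G ((1 - t) * h x + t * h y)"
    using h t by (intro orlicz_function_mono[OF Go] convex_onD) auto
  also have "\<dots> \<le> ennreal (1 - t) * G (h x) + ennreal t * G (h y)"
    using orlicz_function_convexD[OF Go h(2)[of x] h(2)[of y], of "1 - t"] t by simp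
  also have "\<dots> = ennreal ((1 - t) * enn2real (G (h x)) + t * enn2real (G (h y)))"
    using t by (subst fin[OF h(2)[of x]], subst fin[OF h(2)[of y]]) (simp add: ennreal_mult ennreal_plus)
  finally show "enn2real (G (h ((1 - t) *\<^sub>R x + t *\<^sub>R y)))
      \<le> (1 - t) * enn2real (G (h x)) + t * enn2real (G (h y))"
    using t by (intro enn2real_leI) auto
qed auto

text \<open>At a scale \<open>l\<close> strictly between \<open>k\<close> and the norm of
  \<open>Y\<close>, the integral for \<open>Y\<close> exceeds 1. By Fatou the integrals for
  \<open>X n\<close> eventually exceed 1 as well, so \<open>l\<close> is eventually a lower bound of
  their norms.\<close>

lemma luxemburg_norm_liminf:
  assumes G: "real_valued_orlicz_function G"
    and X: "\<And>n. X n \<in> borel_measurable M"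
    and lim: "AE \<omega> in M. (\<lambda>n. X n \<omega>) \<longlonglongrightarrow> Y \<omega>"
    and k: "k < luxemburg_norm M G Y"
  shows "\<forall>\<^sub>F n in sequentially. k < luxemburg_norm M G (X n)"
proof -
  have Go: "orlicz_function G" using G by (simp add: real_valued_orlicz_function_def)
  obtain m where m: "k < m" "m < luxemburg_norm M G Y" using dense[OF k] by auto
  then obtain l where l: "m = ennreal l" "0 \<le> l" by (cases m) auto
  have l0: "0 < l" using m(1) l by (cases "l = 0") auto
  define q where "q x = enn2real (G \<bar>x\<bar>)" for x
  have q: "G \<bar>x\<bar> = ennreal (q x)" for x
    using G by (simp add: q_def real_valued_orlicz_function_def)
  \<comment> \<open>The even extension of \<open>G\<close> is finite and convex on the whole line,
    hence continuous everywhere, including at 0.\<close>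
  have "convex_on UNIV (\<lambda>x. enn2real (G \<bar>x\<bar>))"
    by (rule real_valued_orlicz_compose_convex[OF G]) (use convex_on_dist[of UNIV "0::real"] in \<open>auto simp: dist_real_def\<close>)
  then have cont: "isCont q x" for x
    using convex_on_continuous[of UNIV q] by (simp add: q_def[abs_def] continuous_on_eq_continuous_at)
  have "1 < (\<integral>\<^sup>+\<omega>. G (\<bar>Y \<omega>\<bar> / l) \<partial>M)"
    using luxemburg_norm_le[OF l0, where X = Y and G = G and M = M] m(2) l by (force simp: not_le[symmetric])
  also have "\<dots> = (\<integral>\<^sup>+\<omega>. liminf (\<lambda>n. G (\<bar>X n \<omega>\<bar> / l)) \<partial>M)"
  proof (rule nn_integral_cong_AE, use lim in eventually_elim)
    fix \<omega> assume "(\<lambda>n. X n \<omega>) \<longlonglongrightarrow> Y \<omega>"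
    then have "(\<lambda>n. ennreal (q (X n \<omega> / l))) \<longlonglongrightarrow> ennreal (q (Y \<omega> / l))"
      using l0 by (intro tendsto_ennrealI isCont_tendsto_compose[OF cont] tendsto_divide) auto
    then have "(\<lambda>n. G (\<bar>X n \<omega>\<bar> / l)) \<longlonglongrightarrow> G (\<bar>Y \<omega>\<bar> / l)"
      using l0 by (simp add: q[symmetric])
    then show "G (\<bar>Y \<omega>\<bar> / l) = liminf (\<lambda>n. G (\<bar>X n \<omega>\<bar> / l))"
      by (rule lim_imp_Liminf[symmetric, rotated]) simp
  qed
  also have "\<dots> \<le> liminf (\<lambda>n. \<integral>\<^sup>+\<omega>. G (\<bar>X n \<omega>\<bar> / l) \<partial>M)"
    by (rule nn_integral_liminf) (rule orlicz_function_compose_measurable[OF Go X l0])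
  finally have "\<forall>\<^sub>F n in sequentially. 1 < (\<integral>\<^sup>+\<omega>. G (\<bar>X n \<omega>\<bar> / l) \<partial>M)"
    by (rule less_LiminfD)
  then show ?thesis
  proof eventually_elim
    case (elim n)
    then have "\<not> luxemburg_norm M G (X n) < ennreal l"
      using luxemburg_norm_lessD[OF Go] by (force simp: not_le)
    then show ?case using m(1) l by (simp add: not_less less_le_trans)
  qed
qed

section \<open>The inverse of G at 1 and the extension of F\<close>

text \<open>A real \<open>Sup\<close> is informative only for a nonempty bounded set:
  \<open>G\<close> tending to infinity gives the bound, and \<open>G\<close> tending to 0 at 0 gives
  a positive member.\<close>

lemma orlicz_inverse_1:
  assumes "orlicz_function G"
  shows orlicz_inverse_1_pos: "0 < orlicz_inverse G 1"
    and orlicz_inverse_1_ge: "0 \<le> x \<Longrightarrow> G x \<le> 1 \<Longrightarrow> x \<le> orlicz_inverse G 1"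
proof -
  have "\<forall>\<^sub>F x in at_top. 1 < G x" 
    using assms by (intro order_tendstoD(1)[of G \<infinity>]) (auto simp: orlicz_function_def)
  then obtain B where B: "\<And>x. B \<le> x \<Longrightarrow> 1 < G x" by (auto simp: eventually_at_top_linorder)
  have bdd: "bdd_above {t. 0 < t \<and> G t \<le> 1}"
  proof (rule bdd_aboveI[of _ B])
    fix t assume "t \<in> {t. 0 < t \<and> G t \<le> 1}"
    then show "t \<le> B" using B[of t] by (cases "t \<le> B") auto
  qed
  have "\<forall>\<^sub>F x in at_right 0. G x < 1" 
    using assms by (intro order_tendstoD(2)[of G 0]) (auto simp: orlicz_function_def)
  then obtain b where "0 < b" "\<And>x. 0 < x \<Longrightarrow> x < b \<Longrightarrow> G x < 1"
    unfolding eventually_at_right_field by auto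
  then have b: "b / 2 \<in> {t. 0 < t \<and> G t \<le> 1}" "0 < b" by (auto intro: less_imp_le)
  have "b / 2 \<le> orlicz_inverse G 1" unfolding orlicz_inverse_def using bdd b by (intro cSup_upper) auto
  then show pos: "0 < orlicz_inverse G 1" using b by simp
  assume "0 \<le> x" "G x \<le> 1"
  then show "x \<le> orlicz_inverse G 1"
    using pos bdd by (cases "x = 0") (auto simp: orlicz_inverse_def intro!: cSup_upper)
qed

text \<open>By monotonicity \<open>F 0\<close> is the least value of \<open>F\<close> on [0,
  \<infinity>), and some value is finite. It later bounds near-optimal shifts from below.\<close>

lemma admissible_F_0:
  assumes F: "admissible_F F"
  obtains f0 where "F 0 = ereal f0"
proof -
  obtain x where x: "0 \<le> x" "F x \<noteq> \<infinity>" using F by (auto simp: admissible_F_def)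
  have "F 0 \<le> F x" using F x by (auto simp: admissible_F_def intro: mono_onD)
  moreover have "F 0 > -\<infinity>" using F by (auto simp: admissible_F_def)
  ultimately show ?thesis using x that by (cases "F 0") auto
qed

lemma extend_F_ennreal: "0 \<le> x \<Longrightarrow> extend_F F (ennreal x) = F x"
  by (simp add: extend_F_def)

lemma extend_F_mono:
  assumes F: "admissible_F F" and xy: "x \<le> y"
  shows "extend_F F x \<le> extend_F F y"
proof (cases "y = \<infinity>")
  case False
  then have "x < \<infinity>" "y < \<infinity>" using xy by (auto simp: less_top[symmetric] top_unique)
  then show ?thesis
    using F xy by (auto simp: extend_F_def admissible_F_def less_top intro!: mono_onD[of "{0..}" F] enn2real_mono)
qed (simp add: extend_F_def)

lemma extend_F_ge_0: "admissible_F F \<Longrightarrow> F 0 \<le> extend_F F x"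
  using extend_F_mono[of F 0 x] by (simp add: extend_F_def)

text \<open>This is the lower semicontinuity of \<open>extend_F F\<close>. Left-continuity carries
  the bound to a positive finite \<open>y\<close>; at 0 nothing lies below, so \<open>F 0\<close>
  has its own hypothesis; at infinity the hypothesis would bound \<open>F\<close> everywhere,
  against its limit.\<close>

lemma extend_F_le:
  assumes F: "admissible_F F"
    and F0: "F 0 \<le> ereal b" and le: "\<And>x. 0 \<le> x \<Longrightarrow> ennreal x < y \<Longrightarrow> F x \<le> ereal b"
  shows "extend_F F y \<le> ereal b"
proof (cases y)
  case (real r)
  show ?thesis
  proof (cases "r = 0")
    case False
    then have r: "0 < r" using real by simp
    have "(F \<longlongrightarrow> F r) (at_left r)" using F r by (simp add: admissible_F_def)
    moreover have "\<forall>\<^sub>F x in at_left r. F x \<le> ereal b"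
      using r le by (auto simp: eventually_at_left_field real ennreal_less_iff intro!: exI[of _ 0])
    ultimately have "F r \<le> ereal b" by (intro tendsto_upperbound) auto
    then show ?thesis using real by (simp add: extend_F_ennreal)
  qed (use F0 real in \<open>simp add: extend_F_def\<close>)
next
  case top
  have "\<forall>\<^sub>F x in at_top. ereal b < F x"
    using F by (intro order_tendstoD(1)[of F \<infinity>]) (auto simp: admissible_F_def)
  then obtain B where "\<And>x. B \<le> x \<Longrightarrow> ereal b < F x" by (auto simp: eventually_at_top_linorder)
  then have "ereal b < F (max 0 B)" by simp
  moreover have "F (max 0 B) \<le> ereal b" using top by (intro le) auto
  ultimately show ?thesis by simp
qed

lemma admissible_F_convexD:
  assumes "admissible_F F" "0 \<le> x" "0 \<le> y" "0 < t" "t < 1"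
  shows "F (t * x + (1 - t) * y) \<le> ereal t * F x + ereal (1 - t) * F y"
  using assms by (simp add: admissible_F_def)

text \<open>The finite bounds make both norms finite, after which norm convexity, monotonicity of
  \<open>F\<close> and convexity of \<open>F\<close> combine. \<open>Z\<close> is only dominated by
  the combination, as convexity of \<open>H\<close> will provide no more.\<close>

lemma extend_F_luxemburg_convex:
  assumes F: "admissible_F F" and G: "orlicz_function G"
    and X: "X \<in> borel_measurable M" and Y: "Y \<in> borel_measurable M"
    and a: "extend_F F (luxemburg_norm M G X) \<le> ereal a"
    and b: "extend_F F (luxemburg_norm M G Y) \<le> ereal b"
    and t: "0 < t" "t < 1"
    and Z: "AE \<omega> in M. \<bar>Z \<omega>\<bar> \<le> \<bar>t * X \<omega> + (1 - t) * Y \<omega>\<bar>"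
  shows "extend_F F (luxemburg_norm M G Z) \<le> ereal (t * a + (1 - t) * b)"
proof -
  obtain x where x: "luxemburg_norm M G X = ennreal x" "0 \<le> x"
    using a by (cases "luxemburg_norm M G X") (auto simp: extend_F_def)
  obtain y where y: "luxemburg_norm M G Y = ennreal y" "0 \<le> y"
    using b by (cases "luxemburg_norm M G Y") (auto simp: extend_F_def)
  have "luxemburg_norm M G Z \<le> luxemburg_norm M G (\<lambda>\<omega>. t * X \<omega> + (1 - t) * Y \<omega>)"
    by (rule luxemburg_norm_mono_AE[OF G Z])
  also have "\<dots> \<le> ennreal (t * x + (1 - t) * y)"
    by (rule luxemburg_norm_convex[OF G X Y x(1) y(1) x(2) y(2) t])
  finally have "extend_F F (luxemburg_norm M G Z) \<le> extend_F F (ennreal (t * x + (1 - t) * y))"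
    by (rule extend_F_mono[OF F])
  also have "\<dots> = F (t * x + (1 - t) * y)"
    using x y t by (intro extend_F_ennreal) auto
  also have "\<dots> \<le> ereal t * F x + ereal (1 - t) * F y"
    by (rule admissible_F_convexD[OF F x(2) y(2) t])
  also have "\<dots> \<le> ereal t * ereal a + ereal (1 - t) * ereal b"
    using a b x y t by (intro add_mono ereal_mult_left_mono) (auto simp: extend_F_ennreal)
  finally show ?thesis by simp
qed

section \<open>Growth condition with the constant moved inside F\<close>

text \<open>Both \<open>x\<close> and \<open>y\<close> are convex combinations of 0 and
  \<open>x + y\<close>, with complementary weights; the two convexity inequalities add up.\<close>

lemma convex_increment_superadditive:
  fixes H :: "real \<Rightarrow> real"
  assumes H: "convex_on UNIV H" and "0 \<le> x" "0 \<le> y"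
  shows "H x + H y \<le> H (x + y) + H 0"
proof (cases "x + y = 0")
  case False
  then have s: "0 < x + y" using assms by simp
  define t where "t = x / (x + y)"
  have t: "0 \<le> t" "t \<le> 1" "t * (x + y) = x" "(1 - t) * (x + y) = y"
    using s assms by (auto simp: t_def field_simps)
  have "H x \<le> (1 - t) * H 0 + t * H (x + y)"
    using convex_onD[OF H t(1,2), of 0 "x + y"] t(3) by simp
  moreover have "H y \<le> t * H 0 + (1 - t) * H (x + y)"
    using convex_onD[OF H, of "1 - t" 0 "x + y"] t by simp
  ultimately show ?thesis by (simp add: algebra_simps)
qed (use assms in \<open>simp add: add_nonneg_eq_0_iff\<close>)

text \<open>
  The Luxemburg norm of the constant \<open>H t\<close> is \<open>H t / c\<close> with \<open>c = orlicz_inverse G 1\<close>, so the growth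
  hypothesis is needed with \<open>c\<close> inside \<open>F\<close>.
\<close>

lemma rescaled_growth:
  assumes F: "admissible_F F" and H: "admissible_H H" and c: "0 < c"
    and lim: "((\<lambda>s. F (H s) - ereal (c * s)) \<longlongrightarrow> \<infinity>) at_top"
  shows "\<exists>S. \<forall>t\<ge>S. ereal (t + B) < F (H t / c)"
proof -
  have H0: "0 \<le> H x" for x using H by (simp add: admissible_H_def)
  have Hc: "convex_on UNIV H" using H by (simp add: admissible_H_def)
  have growth: "\<exists>S. \<forall>s\<ge>S. ereal (c * s + A) < F (H s)" for A
  proof -
    have "\<forall>\<^sub>F s in at_top. ereal A < F (H s) - ereal (c * s)"
      using lim by (intro order_tendstoD(1)) auto
    then obtain S where S: "\<And>s. S \<le> s \<Longrightarrow> ereal A < F (H s) - ereal (c * s)"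
      by (auto simp: eventually_at_top_linorder)
    show ?thesis
    proof (intro exI allI impI)
      fix s assume "S \<le> s"
      with S[OF this] show "ereal (c * s + A) < F (H s)" by (cases "F (H s)") auto
    qed
  qed
  obtain f0 where f0: "F 0 = ereal f0" by (rule admissible_F_0[OF F])
  consider "c < 1" | "1 \<le> c" by linarith
  then show ?thesis
  proof cases
    case 1
    \<comment> \<open>convexity of \<open>F\<close> between \<open>0\<close> and \<open>H t / c\<close>\<close>
    obtain S where S: "\<And>s. S \<le> s \<Longrightarrow> ereal (c * s + (c * B + (1 - c) * f0)) < F (H s)"
      using growth[of "c * B + (1 - c) * f0"] by auto
    show ?thesis
    proof (intro exI allI impI)
      fix t assume "S \<le> t"
      note S[OF this]
      also have "F (H t) = F (c * (H t / c) + (1 - c) * 0)" using c by simp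
      also have "\<dots> \<le> ereal c * F (H t / c) + ereal (1 - c) * F 0"
        using c 1 H0 by (intro admissible_F_convexD[OF F]) auto
      finally have *: "ereal (c * t + (c * B + (1 - c) * f0)) < ereal c * F (H t / c) + ereal (1 - c) * F 0" .
      show "ereal (t + B) < F (H t / c)"
      proof (cases "F (H t / c)")
        case (real r)
        \<comment> \<open>The term \<open>(1 - c) * f0\<close> in the chosen growth constant cancels
          the contribution of \<open>F 0\<close>.\<close>
        then have "c * (t + B) < c * r" using * f0 by (simp add: algebra_simps)
        then show ?thesis using c real by simp
      next
        case MInf
        then show ?thesis using F H0[of t] c by (auto simp: admissible_F_def)
      qed auto
    qed
  next
    case 2
    \<comment> \<open>\<open>H (c * (s + u)) / c \<ge> H s\<close> for a fixed shift \<open>u\<close>, by convexity of \<open>H\<close>\<close>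
    have "\<forall>\<^sub>F u in at_top. 2 * H 0 \<le> H u"
      using H by (auto simp: admissible_H_def filterlim_at_top)
    then obtain U where U: "\<And>u. U \<le> u \<Longrightarrow> 2 * H 0 \<le> H u" by (auto simp: eventually_at_top_linorder)
    \<comment> \<open>\<open>H u\<close> must absorb \<open>H 0\<close> twice: once from
      superadditivity and once from interpolating \<open>H\<close> between 0 and
      \<open>t\<close>.\<close>
    define u where "u = max 0 U"
    have u: "0 \<le> u" "2 * H 0 \<le> H u" using U by (auto simp: u_def)
    obtain S where S: "\<And>s. S \<le> s \<Longrightarrow> ereal (c * s + (c * u + B)) < F (H s)"
      using growth[of "c * u + B"] by auto
    show ?thesis
    proof (intro exI[of _ "c * (max 0 S + u)"] allI impI)
      fix t assume t: "c * (max 0 S + u) \<le> t"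
      \<comment> \<open>Then \<open>c * s + (c * u + B)\<close> equals \<open>t + B\<close>, and the
        threshold on \<open>t\<close> makes \<open>s\<close> at least 0 and at least
        \<open>S\<close>.\<close>
      define s where "s = t / c - u"
      have ts: "t = c * (s + u)" using c by (simp add: s_def)
      have "max 0 S \<le> s" using t c unfolding ts by simp
      then have s: "0 \<le> s" "S \<le> s" by auto
      have "H s + H u \<le> H (s + u) + H 0"
        by (rule convex_increment_superadditive[OF Hc s(1) u(1)])
      moreover have "H (s + u) \<le> (1 - 1 / c) * H 0 + 1 / c * H t"
        using convex_onD[OF Hc, of "1 / c" 0 t] 2 c by (simp add: ts)
      moreover have "(1 - 1 / c) * H 0 \<le> H 0"
        using c H0[of 0] by (simp add: left_diff_distrib)
      ultimately have "H s \<le> H t / c" using u(2) by simp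
      then have "F (H s) \<le> F (H t / c)"
        using F H0[of s] by (auto simp: admissible_F_def intro: mono_onD)
      then have "ereal (c * s + (c * u + B)) < F (H t / c)" using S[OF s(2)] by simp
      then show "ereal (t + B) < F (H t / c)" by (simp add: ts algebra_simps)
    qed
  qed
qed

section \<open>The functional given by the infimum formula\<close>

locale transformed_norm = prob_space M for M :: "'a measure" +
  fixes F :: "real \<Rightarrow> ereal" and G :: "real \<Rightarrow> ennreal" and H :: "real \<Rightarrow> real"
  assumes F: "admissible_F F" and G: "real_valued_orlicz_function G" and H: "admissible_H H"
    and growth: "((\<lambda>s. F (H s) - ereal (orlicz_inverse G 1 * s)) \<longlongrightarrow> \<infinity>) at_top"
begin

abbreviation N :: "real \<Rightarrow> ('a \<Rightarrow> real) \<Rightarrow> ennreal" where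
  "N s X \<equiv> luxemburg_norm M G (\<lambda>\<omega>. H (s - X \<omega>))"

definition Tbar :: "('a \<Rightarrow> real) \<Rightarrow> ereal" where
  "Tbar X = (INF s::real. extend_F F (N s X) - ereal s)"

lemma G_orlicz: "orlicz_function G"
  using G by (simp add: real_valued_orlicz_function_def)

lemma H_nonneg: "0 \<le> H x"
  and H_mono: "x \<le> y \<Longrightarrow> H x \<le> H y"
  and H_convex: "convex_on UNIV H"
  using H by (auto simp: admissible_H_def intro: monoD)

lemma H_continuous: "continuous_on UNIV H"
  using convex_on_continuous[OF _ H_convex] by simp

lemma H_measurable [measurable]: "H \<in> borel_measurable borel"
  using H_continuous by (rule borel_measurable_continuous_onI)

text \<open>Together with \<open>Tbar_less\<close> this replaces the subtraction inside the infimum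
  by a comparison with a finite right side, so that infinite values of \<open>F\<close> need no
  separate treatment.\<close>

lemma Tbar_le:
  assumes "extend_F F (N s X) \<le> ereal (a + s)"
  shows "Tbar X \<le> ereal a"
  unfolding Tbar_def
  by (rule INF_lower2[of s]) (use assms in \<open>cases "extend_F F (N s X)"; simp\<close>)+

lemma Tbar_less:
  assumes "Tbar X < ereal a"
  obtains s where "extend_F F (N s X) \<le> ereal (a + s)"
proof -
  obtain s where s: "extend_F F (N s X) - ereal s < ereal a"
    using assms by (auto simp: Tbar_def INF_less_iff)
  then have "extend_F F (N s X) \<le> ereal (a + s)" by (cases "extend_F F (N s X)") auto
  then show ?thesis by (rule that)
qed

lemma Tbar_mono: "(\<And>s. N s X \<le> N s Y) \<Longrightarrow> Tbar X \<le> Tbar Y"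
  unfolding Tbar_def by (intro INF_mono' ereal_minus_mono extend_F_mono[OF F]) auto

text \<open>Reflecting and shifting the argument preserves convexity of \<open>H\<close>. This
  composite is the function to which Jensen is applied at each scale \<open>l\<close>.\<close>

lemma G_H_convex:
  assumes l: "0 < l"
  shows "convex_on UNIV (\<lambda>x. enn2real (G (H (s - x) / l)))"
proof (rule real_valued_orlicz_compose_convex[OF G])
  show "0 \<le> H (s - x) / l" for x using H_nonneg l by simp
  show "convex_on UNIV (\<lambda>x. H (s - x) / l)"
  proof (rule convex_onI)
    fix t x y :: real assume t: "0 < t" "t < 1"
    have "H ((1 - t) * (s - x) + t * (s - y)) \<le> (1 - t) * H (s - x) + t * H (s - y)"
      using convex_onD[OF H_convex, of t "s - x" "s - y"] t by simp
    moreover have "s - ((1 - t) * x + t * y) = (1 - t) * (s - x) + t * (s - y)" by algebra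
    ultimately have "H (s - ((1 - t) * x + t * y)) / l \<le> ((1 - t) * H (s - x) + t * H (s - y)) / l"
      using l by (simp add: divide_right_mono)
    then show "H (s - ((1 - t) *\<^sub>R x + t *\<^sub>R y)) / l \<le> (1 - t) * (H (s - x) / l) + t * (H (s - y) / l)"
      by (simp add: add_divide_distrib)
  qed auto
qed

lemma G_H_eq: "0 < l \<Longrightarrow> G (\<bar>H x\<bar> / l) = ennreal (enn2real (G (H x / l)))"
  using G H_nonneg[of x] by (simp add: real_valued_orlicz_function_def)

lemma N_partition_cond_exp_le:
  assumes "\<pi> \<in> finite_partitions M" and "X \<in> L1 M"
  shows "N s (partition_cond_exp M \<pi> X) \<le> N s X"
  unfolding partition_cond_exp_def
  using assms nn_integral_convex_cond_exp_le[OF subalgebra_sigma_partition _ G_H_convex]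
  by (intro luxemburg_norm_le_norm) (simp add: G_H_eq L1_def)

text \<open>For an admissible scale \<open>l\<close>, Jensen gives G (H (s - E X) / l) \<le> 1,
  hence H (s - E X) / l is at most \<open>orlicz_inverse G 1\<close>.\<close>

lemma N_ge_expectation:
  assumes X: "X \<in> L1 M"
  shows "ennreal (H (s - expectation X) / orlicz_inverse G 1) \<le> N s X"
  unfolding luxemburg_norm_def
proof (rule Inf_greatest, clarify)
  fix l :: real assume l: "0 < l" and le: "(\<integral>\<^sup>+\<omega>. G (\<bar>H (s - X \<omega>)\<bar> / l) \<partial>M) \<le> 1"
  have "G (H (s - expectation X) / l) = ennreal (enn2real (G (H (s - expectation X) / l)))"
    using G_H_eq[OF l] H_nonneg by simp
  also have "\<dots> \<le> (\<integral>\<^sup>+\<omega>. ennreal (enn2real (G (H (s - X \<omega>) / l))) \<partial>M)"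
    using X convex_expectation_le_nn_integral[OF _ G_H_convex[OF l]] by (simp add: L1_def)
  also have "\<dots> \<le> 1" using le l by (simp add: G_H_eq)
  finally have "H (s - expectation X) / l \<le> orlicz_inverse G 1"
    using H_nonneg l by (intro orlicz_inverse_1_ge[OF G_orlicz]) auto
  then show "ennreal (H (s - expectation X) / orlicz_inverse G 1) \<le> ennreal l"
    using l orlicz_inverse_1_pos[OF G_orlicz] by (intro ennreal_leI) (simp add: divide_simps mult.commute)
qed

section \<open>Compactness of near-optimal shifts and sequential lower semicontinuity\<close>

text \<open>The lower bound comes from \<open>F 0\<close>, the upper one from the growth condition
  at \<open>s - expectation X\<close>. Both depend only on \<open>K\<close> and \<open>a\<close>,
  hence are uniform along a sequence with bounded expectations.\<close>

lemma Tbar_bounded_optimizers: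
  obtains lo hi where "\<And>X s. X \<in> L1 M \<Longrightarrow> \<bar>expectation X\<bar> \<le> K \<Longrightarrow>
    extend_F F (N s X) \<le> ereal (a + s) \<Longrightarrow> lo \<le> s \<and> s \<le> hi"
proof -
  let ?c = "orlicz_inverse G 1"
  obtain f0 where f0: "F 0 = ereal f0" by (rule admissible_F_0[OF F])
  \<comment> \<open>The slack \<open>a + K\<close> covers the level \<open>a\<close> and the largest
    possible expectation.\<close>
  obtain S where S: "\<And>t. S \<le> t \<Longrightarrow> ereal (t + (a + K)) < F (H t / ?c)"
    using rescaled_growth[OF F H orlicz_inverse_1_pos[OF G_orlicz] growth, of "a + K"] by auto
  show ?thesis
  proof (rule that[of "f0 - a" "S + K"], intro conjI)
    fix X s assume X: "X \<in> L1 M" "\<bar>expectation X\<bar> \<le> K" and s: "extend_F F (N s X) \<le> ereal (a + s)"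
    have "ereal f0 \<le> ereal (a + s)" using order_trans[OF extend_F_ge_0[OF F] s] f0 by simp
    then show "f0 - a \<le> s" by simp
    show "s \<le> S + K"
    proof (rule ccontr)
      assume "\<not> s \<le> S + K"
      then have "S \<le> s - expectation X" using X(2) by linarith
      note S[OF this]
      also have "F (H (s - expectation X) / ?c) = extend_F F (ennreal (H (s - expectation X) / ?c))"
        using H_nonneg orlicz_inverse_1_pos[OF G_orlicz] by (intro extend_F_ennreal[symmetric]) (simp add: less_imp_le)
      also have "\<dots> \<le> extend_F F (N s X)"
        by (rule extend_F_mono[OF F N_ge_expectation[OF X(1)]])
      also note s
      finally show False using X(2) by simp
    qed
  qed
qed

lemma Tbar_sequential_lsc:
  assumes Y: "\<And>n. Y n \<in> L1 M" and X: "X \<in> L1 M"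
    and lim: "(\<lambda>n. L1_norm M (\<lambda>\<omega>. Y n \<omega> - X \<omega>)) \<longlonglongrightarrow> 0"
    and RY: "\<And>n. Tbar (Y n) \<le> ereal a"
  shows "Tbar X \<le> ereal a"
proof (rule ereal_le_epsilon2)
  fix e :: real assume e: "0 < e"
  have Xi: "integrable M X" and Yi: "\<And>n. integrable M (Y n)" using X Y by (auto simp: L1_def)
  obtain r1 :: "nat \<Rightarrow> nat" where r1: "strict_mono r1" "AE \<omega> in M. (\<lambda>n. Y (r1 n) \<omega> - X \<omega>) \<longlonglongrightarrow> 0"
    using tendsto_L1_AE_subseq[of M "\<lambda>n \<omega>. Y n \<omega> - X \<omega>"] lim Xi Yi by (auto simp: L1_norm_def)
  \<comment> \<open>The slack \<open>e\<close> makes the comparison strict, so a suitable shift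
    exists even if the infimum is not attained.\<close>
  have "\<exists>s. extend_F F (N s (Y n)) \<le> ereal ((a + e) + s)" for n
  proof -
    have "Tbar (Y n) < ereal (a + e)" using RY[of n] e by (simp add: le_less_trans)
    then show ?thesis by (rule Tbar_less) blast
  qed
  then obtain s where s: "\<And>n. extend_F F (N (s n) (Y n)) \<le> ereal ((a + e) + s n)" by metis
  have "Bseq (\<lambda>n. L1_norm M (\<lambda>\<omega>. Y n \<omega> - X \<omega>))"
    using lim by (intro convergent_imp_Bseq convergentI)
  then obtain C where C: "\<And>n. \<bar>L1_norm M (\<lambda>\<omega>. Y n \<omega> - X \<omega>)\<bar> \<le> C" by (auto simp: Bseq_def)
  have EY: "\<bar>expectation (Y n)\<bar> \<le> \<bar>expectation X\<bar> + C" for n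
  proof -
    have "\<bar>expectation (Y n) - expectation X\<bar> = \<bar>expectation (\<lambda>\<omega>. Y n \<omega> - X \<omega>)\<bar>"
      using Xi Yi by simp
    also have "\<dots> \<le> L1_norm M (\<lambda>\<omega>. Y n \<omega> - X \<omega>)" unfolding L1_norm_def by (rule integral_abs_bound)
    also have "\<dots> \<le> C" using C[of n] by simp
    finally show ?thesis by linarith
  qed
  obtain lo hi where b: "\<And>n. lo \<le> s n \<and> s n \<le> hi"
    using Tbar_bounded_optimizers[of "\<bar>expectation X\<bar> + C" "a + e"] Y EY s by metis
  have "bounded (range (s \<circ> r1))"
    by (rule bounded_subset[OF bounded_closed_interval[of lo hi]]) (use b in auto)
  \<comment> \<open>The second subsequence is taken inside \<open>r1\<close>, so almost sure
    convergence survives while the shifts converge to \<open>q\<close>.\<close>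
  then obtain q and r2 :: "nat \<Rightarrow> nat" where r2: "strict_mono r2" "((s \<circ> r1) \<circ> r2) \<longlonglongrightarrow> q"
    using bounded_imp_convergent_subsequence by blast
  define r where "r n = r1 (r2 n)" for n
  have sr: "(\<lambda>n. s (r n)) \<longlonglongrightarrow> q" using r2(2) by (simp add: r_def o_def)
  have Yr: "AE \<omega> in M. (\<lambda>n. Y (r n) \<omega>) \<longlonglongrightarrow> X \<omega>"
    using r1(2)
  proof eventually_elim
    case (elim \<omega>)
    then have "(\<lambda>n. Y (r n) \<omega> - X \<omega>) \<longlonglongrightarrow> 0"
      using LIMSEQ_subseq_LIMSEQ[OF _ r2(1)] by (force simp: r_def o_def)
    then show ?case by (simp add: LIM_zero_iff)
  qed
  have "AE \<omega> in M. (\<lambda>n. H (s (r n) - Y (r n) \<omega>)) \<longlonglongrightarrow> H (q - X \<omega>)"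
    using Yr
  proof eventually_elim
    case (elim \<omega>)
    show ?case
      using H_continuous by (intro isCont_tendsto_compose[of _ H] tendsto_diff sr elim)
        (simp add: continuous_on_eq_continuous_at)
  qed
  then have lower: "\<forall>\<^sub>F n in sequentially. k < N (s (r n)) (Y (r n))" if "k < N q X" for k
    using that Yi by (intro luxemburg_norm_liminf[OF G, of "\<lambda>n \<omega>. H (s (r n) - Y (r n) \<omega>)"]) auto
  have slim: "(\<lambda>n. ereal ((a + e) + s (r n))) \<longlonglongrightarrow> ereal ((a + e) + q)"
    by (intro tendsto_intros sr)
  \<comment> \<open>The limit shift \<open>q\<close> is near-optimal for \<open>X\<close>: each
    \<open>x\<close> below \<open>N q X\<close> is eventually below the norms along the sequence, so
    \<open>F x\<close> obeys their bounds, which pass to the limit.\<close>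
  have "extend_F F (N q X) \<le> ereal ((a + e) + q)"
  proof (rule extend_F_le[OF F])
    have "F 0 \<le> ereal ((a + e) + s (r n))" for n
      using extend_F_ge_0[OF F] s[of "r n"] by (rule order_trans)
    then show "F 0 \<le> ereal ((a + e) + q)"
      by (intro tendsto_lowerbound[OF slim]) auto
    fix x :: real assume x: "0 \<le> x" "ennreal x < N q X"
    have "\<forall>\<^sub>F n in sequentially. F x \<le> ereal ((a + e) + s (r n))"
      using lower[OF x(2)]
    proof eventually_elim
      case (elim n)
      have "F x = extend_F F (ennreal x)" using x(1) by (simp add: extend_F_ennreal)
      also have "\<dots> \<le> extend_F F (N (s (r n)) (Y (r n)))"
        using elim by (intro extend_F_mono[OF F]) auto
      also note s
      finally show ?case .
    qed
    then show "F x \<le> ereal ((a + e) + q)"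
      by (intro tendsto_lowerbound[OF slim]) auto
  qed
  then have "Tbar X \<le> ereal (a + e)" by (rule Tbar_le)
  then show "Tbar X \<le> ereal a + ereal e" by simp
qed

section \<open>Identification with the supremum over partitions\<close>

lemma norm_transform_eq_Tbar:
  assumes "X \<in> transform_domain M G H"
  shows "norm_transform M F G H X = Tbar X"
proof -
  have "N s X \<noteq> \<infinity>" for s
    using assms luxemburg_norm_finite[OF G_orlicz, of "\<lambda>\<omega>. H (s - X \<omega>)" M]
    by (auto simp: transform_domain_def)
  then show ?thesis by (simp add: norm_transform_def Tbar_def extend_F_def)
qed

lemma Tbar_partition_cond_exp_le:
  assumes "\<pi> \<in> finite_partitions M" and "X \<in> L1 M"
  shows "Tbar (partition_cond_exp M \<pi> X) \<le> Tbar X"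
  by (rule Tbar_mono[OF N_partition_cond_exp_le[OF assms]])

text \<open>Jensen bounds the supremum by \<open>Tbar X\<close>. Conversely, partitions whose
  conditional expectations converge to \<open>X\<close> in L1 turn any real level above the supremum
  into a bound for \<open>Tbar X\<close>, by sequential lower semicontinuity.\<close>

lemma extended_transform_eq_Tbar:
  assumes X: "X \<in> L1 M"
  shows "extended_transform M F G H X = Tbar X"
proof -
  have eq: "extended_transform M F G H X = (SUP \<pi>\<in>finite_partitions M. Tbar (partition_cond_exp M \<pi> X))"
    unfolding extended_transform_def
    by (intro SUP_cong refl norm_transform_eq_Tbar partition_cond_exp_in_transform_domain[OF prob_space_axioms G H])
  have "\<exists>\<pi>\<in>finite_partitions M.
      L1_norm M (\<lambda>\<omega>. partition_cond_exp M \<pi> X \<omega> - X \<omega>) < inverse (real (Suc n))" for n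
    by (rule partition_cond_exp_approx[OF X, of "inverse (real (Suc n))"]) auto
  then obtain \<pi> where pi: "\<And>n. \<pi> n \<in> finite_partitions M"
    "\<And>n. L1_norm M (\<lambda>\<omega>. partition_cond_exp M (\<pi> n) X \<omega> - X \<omega>) < inverse (real (Suc n))"
    by metis
  have lim: "(\<lambda>n. L1_norm M (\<lambda>\<omega>. partition_cond_exp M (\<pi> n) X \<omega> - X \<omega>)) \<longlonglongrightarrow> 0"
    by (rule tendsto_sandwich[OF _ _ tendsto_const LIMSEQ_inverse_real_of_nat])
       (use pi(2) in \<open>auto simp: L1_norm_def less_imp_le\<close>)
  have "Tbar X \<le> (SUP \<pi>\<in>finite_partitions M. Tbar (partition_cond_exp M \<pi> X))" (is "_ \<le> ?S")
  proof (rule dense_ge)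
    fix z assume z: "?S < z"
    show "Tbar X \<le> z"
    proof (cases z)
      case (real a)
      have "Tbar (partition_cond_exp M (\<pi> n) X) \<le> ereal a" for n
        using SUP_upper[OF pi(1)[of n], of "\<lambda>\<pi>. Tbar (partition_cond_exp M \<pi> X)"] z real by simp
      with Tbar_sequential_lsc[OF partition_cond_exp_L1[OF pi(1) X] X lim] show ?thesis
        unfolding real by blast
    qed (use z in auto)
  qed
  moreover have "?S \<le> Tbar X"
    by (intro SUP_least Tbar_partition_cond_exp_le X)
  ultimately show ?thesis using eq by simp
qed

section \<open>Closed sublevel sets, convexity, monotonicity and cash-additivity\<close>

lemma Tbar_lower_semicontinuous:
  "closedin (L1_topology M) {X \<in> L1 M. Tbar X \<le> ereal a}"
  unfolding closedin_def topspace_L1_topology openin_L1_topology L1_open_def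
proof (intro conjI ballI)
  fix X assume X: "X \<in> L1 M - {X \<in> L1 M. Tbar X \<le> ereal a}"
  show "\<exists>e>0. \<forall>Y\<in>L1 M. L1_norm M (\<lambda>\<omega>. Y \<omega> - X \<omega>) < e \<longrightarrow> Y \<in> L1 M - {X \<in> L1 M. Tbar X \<le> ereal a}"
  proof (rule ccontr)
    assume "\<not> ?thesis"
    \<comment> \<open>If the complement is not open at \<open>X\<close>, points of the sublevel set
      converge to \<open>X\<close>, and sequential lower semicontinuity puts \<open>X\<close> into
      that set.\<close>
    then have "\<exists>Y\<in>L1 M. L1_norm M (\<lambda>\<omega>. Y \<omega> - X \<omega>) < inverse (real (Suc n)) \<and> Tbar Y \<le> ereal a" for n
      by (auto dest!: spec[of _ "inverse (real (Suc n))"])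
    then obtain Y where Y: "\<And>n. Y n \<in> L1 M"
      "\<And>n. L1_norm M (\<lambda>\<omega>. Y n \<omega> - X \<omega>) < inverse (real (Suc n))" "\<And>n. Tbar (Y n) \<le> ereal a"
      by metis
    have "(\<lambda>n. L1_norm M (\<lambda>\<omega>. Y n \<omega> - X \<omega>)) \<longlonglongrightarrow> 0"
      by (rule tendsto_sandwich[OF _ _ tendsto_const LIMSEQ_inverse_real_of_nat])
         (use Y(2) in \<open>auto simp: L1_norm_def less_imp_le\<close>)
    with Tbar_sequential_lsc[OF Y(1) _ _ Y(3)] X show False by auto
  qed
qed auto

text \<open>If \<open>u\<close> and \<open>v\<close> are near-optimal shifts for \<open>X\<close>
  and \<open>Y\<close>, then \<open>t * u + (1 - t) * v\<close> serves for the combination, by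
  convexity of \<open>H\<close>. The remaining work is to treat infinite values.\<close>

lemma Tbar_convex:
  assumes X: "X \<in> L1 M" and Y: "Y \<in> L1 M" and t: "0 < t" "t < 1"
  shows "Tbar (\<lambda>\<omega>. t * X \<omega> + (1 - t) * Y \<omega>) \<le> ereal t * Tbar X + ereal (1 - t) * Tbar Y" (is "Tbar ?Z \<le> _")
proof -
  have [measurable]: "X \<in> borel_measurable M" "Y \<in> borel_measurable M" using X Y by (auto simp: L1_def)
  have *: "Tbar ?Z \<le> ereal (t * a + (1 - t) * b)" if lt: "Tbar X < ereal a" "Tbar Y < ereal b" for a b
  proof -
    obtain u where u: "extend_F F (N u X) \<le> ereal (a + u)" using lt(1) by (rule Tbar_less)
    obtain v where v: "extend_F F (N v Y) \<le> ereal (b + v)" using lt(2) by (rule Tbar_less)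
    have "extend_F F (N (t * u + (1 - t) * v) ?Z) \<le> ereal (t * (a + u) + (1 - t) * (b + v))"
    proof (rule extend_F_luxemburg_convex[OF F G_orlicz _ _ u v t], goal_cases)
      case 3
      have "H (t * u + (1 - t) * v - ?Z \<omega>) \<le> t * H (u - X \<omega>) + (1 - t) * H (v - Y \<omega>)" for \<omega>
      proof -
        have "t * u + (1 - t) * v - ?Z \<omega> = t * (u - X \<omega>) + (1 - t) * (v - Y \<omega>)" by algebra
        then show ?thesis
          using convex_onD[OF H_convex, of "1 - t" "u - X \<omega>" "v - Y \<omega>"] t by simp
      qed
      then show ?case using H_nonneg t by (auto intro!: AE_I2 simp: order_trans[OF _ abs_ge_self])
    qed measurable
    also have "t * (a + u) + (1 - t) * (b + v) = (t * a + (1 - t) * b) + (t * u + (1 - t) * v)" by algebra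
    finally show ?thesis by (rule Tbar_le)
  qed
  show ?thesis
  proof (rule dense_ge)
    fix z assume z: "ereal t * Tbar X + ereal (1 - t) * Tbar Y < z"
    have fin: "Tbar X \<noteq> \<infinity>" "Tbar Y \<noteq> \<infinity>" using z t by auto
    show "Tbar ?Z \<le> z"
    proof (cases z)
      case (real w)
      \<comment> \<open>Two finite values are both raised by the whole gap \<open>e\<close>, whose
        weights sum to 1. If one value is \<open>-\<infinity>\<close>, its level is obtained by
        solving the equation with right side \<open>w\<close>.\<close>
      have "\<exists>a b. Tbar X < ereal a \<and> Tbar Y < ereal b \<and> t * a + (1 - t) * b \<le> w"
      proof (cases "Tbar X")
        case x: (real x)
        show ?thesis
        proof (cases "Tbar Y")
          case (real y)
          define e where "e = w - (t * x + (1 - t) * y)"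
          have "0 < e" using z \<open>z = ereal w\<close> x real by (simp add: e_def)
          moreover have "t * (x + e) + (1 - t) * (y + e) = w" by (simp add: e_def algebra_simps)
          ultimately show ?thesis using x real by (intro exI[of _ "x + e"] exI[of _ "y + e"]) auto
        next
          case MInf
          then show ?thesis using x t
            by (intro exI[of _ "x + 1"] exI[of _ "(w - t * (x + 1)) / (1 - t)"]) auto
        qed (use fin in simp)
      next
        case MInf
        obtain y where "Tbar Y < ereal y" using fin(2) less_PInf_Ex_of_nat by blast
        then show ?thesis using MInf t
          by (intro exI[of _ "(w - (1 - t) * y) / t"] exI[of _ y]) auto
      qed (use fin in simp)
      then obtain a b where ab: "Tbar X < ereal a" "Tbar Y < ereal b" "t * a + (1 - t) * b \<le> w" by blast
      have "Tbar ?Z \<le> ereal (t * a + (1 - t) * b)" using ab(1,2) by (rule *)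
      also have "\<dots> \<le> z" using ab(3) real by simp
      finally show ?thesis .
    qed (use z in auto)
  qed
qed

lemma Tbar_antimono:
  assumes "AE \<omega> in M. Y \<omega> \<le> X \<omega>"
  shows "Tbar X \<le> Tbar Y"
proof (rule Tbar_mono, rule luxemburg_norm_mono_AE[OF G_orlicz])
  fix s
  show "AE \<omega> in M. \<bar>H (s - X \<omega>)\<bar> \<le> \<bar>H (s - Y \<omega>)\<bar>"
    using assms by eventually_elim (use H_nonneg H_mono in auto)
qed

text \<open>Replacing the shift \<open>s\<close> by \<open>s + r\<close> gives one inequality for
  all \<open>X\<close> and \<open>r\<close>; the other is the same inequality for X + r and
  \<open>- r\<close>.\<close>

lemma Tbar_cash_additive: "Tbar (\<lambda>\<omega>. X \<omega> + r) = Tbar X - ereal r"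
proof -
  have le: "Tbar (\<lambda>\<omega>. X \<omega> + r) \<le> Tbar X - ereal r" for X r
  proof (rule dense_ge)
    fix z assume z: "Tbar X - ereal r < z"
    show "Tbar (\<lambda>\<omega>. X \<omega> + r) \<le> z"
    proof (cases z)
      case (real w)
      then have "Tbar X < ereal (w + r)" using z by (cases "Tbar X") auto
      then obtain s where "extend_F F (N s X) \<le> ereal (w + r + s)" by (rule Tbar_less)
      then show ?thesis unfolding real by (intro Tbar_le[of "s + r"]) (simp add: add_ac)
    qed (use z in auto)
  qed
  have "Tbar X \<le> Tbar (\<lambda>\<omega>. X \<omega> + r) - ereal (- r)" using le[of "\<lambda>\<omega>. X \<omega> + r" "- r"] by simp
  then have "Tbar X - ereal r \<le> Tbar (\<lambda>\<omega>. X \<omega> + r)"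
    by (cases "Tbar X"; cases "Tbar (\<lambda>\<omega>. X \<omega> + r)") auto
  with le show ?thesis by (rule antisym)
qed

end

section \<open>Transfer of the properties to the extended transform\<close>

theorem theorem12:
  fixes M :: "'a measure"
    and F :: "real \<Rightarrow> ereal"
    and G :: "real \<Rightarrow> ennreal"
    and H :: "real \<Rightarrow> real"
  assumes "prob_space M" and "nonatomic M"
    and "admissible_F F" and "real_valued_orlicz_function G" and "admissible_H H"
    and "((\<lambda>s. F (H s) - ereal (orlicz_inverse G 1 * s)) \<longlongrightarrow> \<infinity>) at_top"
  shows "L1_lower_semicontinuous M (extended_transform M F G H)
    \<and> L1_convex M (extended_transform M F G H)
    \<and> L1_monotone M (extended_transform M F G H)
    \<and> L1_cash_additive M (extended_transform M F G H)
    \<and> L1_dilatation_monotone M (extended_transform M F G H)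
    \<and> (\<forall>X\<in>L1 M. extended_transform M F G H X =
         (INF s::real. extend_F F (luxemburg_norm M G (\<lambda>\<omega>. H (s - X \<omega>))) - ereal s))"
proof -
  interpret prob_space M by fact
  interpret transformed_norm M F G H by unfold_locales (use assms in auto)
  \<comment> \<open>The equality holds on L1 only, so convex combinations, shifts and conditional
    expectations must be seen to stay in L1.\<close>
  note eq = extended_transform_eq_Tbar
  have "{X \<in> L1 M. extended_transform M F G H X \<le> ereal l} = {X \<in> L1 M. Tbar X \<le> ereal l}" for l
    using eq by auto
  then have "L1_lower_semicontinuous M (extended_transform M F G H)"
    using Tbar_lower_semicontinuous by (simp add: L1_lower_semicontinuous_def)
  moreover have "L1_convex M (extended_transform M F G H)"
    unfolding L1_convex_def
  proof (intro ballI)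
    fix X Y and t :: real assume XY: "X \<in> L1 M" "Y \<in> L1 M" and t: "t \<in> {0<..<1}"
    have "(\<lambda>\<omega>. t * X \<omega> + (1 - t) * Y \<omega>) \<in> L1 M" using XY by (simp add: L1_def)
    then show "extended_transform M F G H (\<lambda>\<omega>. t * X \<omega> + (1 - t) * Y \<omega>)
        \<le> ereal t * extended_transform M F G H X + ereal (1 - t) * extended_transform M F G H Y"
      using Tbar_convex[OF XY] XY t by (simp add: eq)
  qed
  moreover have "L1_monotone M (extended_transform M F G H)"
    using Tbar_antimono by (simp add: L1_monotone_def eq)
  moreover have "L1_cash_additive M (extended_transform M F G H)"
    unfolding L1_cash_additive_def
  proof (intro ballI allI)
    fix X and s :: real assume X: "X \<in> L1 M"
    then have "(\<lambda>\<omega>. X \<omega> + s) \<in> L1 M" by (simp add: L1_def)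
    with X show "extended_transform M F G H (\<lambda>\<omega>. X \<omega> + s) = extended_transform M F G H X - ereal s"
      by (simp add: eq Tbar_cash_additive)
  qed
  moreover have "L1_dilatation_monotone M (extended_transform M F G H)"
    using Tbar_partition_cond_exp_le by (simp add: L1_dilatation_monotone_def eq partition_cond_exp_L1)
  moreover have "\<forall>X\<in>L1 M. extended_transform M F G H X =
      (INF s::real. extend_F F (luxemburg_norm M G (\<lambda>\<omega>. H (s - X \<omega>))) - ereal s)"
    by (simp add: eq Tbar_def)
  ultimately show ?thesis by blast
qed

end
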